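(* Let $D$ be a weighted oriented graph, let $U\subseteq V^+(D)$ be the set of vertices of non-trivial weight which are sinks, and let $D'$ be the weighted oriented graph obtained from $D$ by replacing the weight of each vertex of $U$ by $1$. Let $I=I(D)$ and $\tilde I=I(D')$. Then for each $s\ge1$, $\tilde I^{(s)}=\tilde I^{\,s}$ if and only if $I^{(s)}=I^s$.
   Context: Let $k$ be a field. A weighted oriented graph $D=(V(D),E(D),w)$ has a finite vertex set $V(D)$, a set $E(D)$ of ordered pairs of distinct vertices ($(x,y)\in E(D)$ is a directed edge from $x$ to $y$), each edge $\{x,y\}$ of the underlying simple graph $G$ carrying exactly one orientation, and a weight function $w:V(D)\to\mathbb N=\{1,2,\dots\}$. A vertex is a source (resp. sink) if it has only outgoing (resp. only incoming) edges; convention: sources have weight $1$. $V^+(D)=\{x:w(x)\ne1\}$. The edge ideal of $D$ is $I(D)=(x\,y^{w(y)} : (x,y)\in E(D))$ in the polynomial ring $R$ over $k$ whose variables are the vertices of $D$. For $s\ge1$ the $s$-th symbolic power of an ideal $I$ is $I^{(s)}=\bigcap_{P\in\operatorname{Ass}(I)}(I^sR_P\cap R)$, where $\operatorname{Ass}(I)$ is the set of associated primes of $R/I$. *)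

theory Defs
  imports "HOL-Library.Poly_Mapping" "HOL-Algebra.QuotRing" "HOL-Algebra.Ideal_Product"
begin

section \<open>Weighted oriented graphs\<close>

record 'v wo_graph =
  verts :: "'v set"
  edges :: "('v \<times> 'v) set"
  weight :: "'v \<Rightarrow> nat"

text \<open>An isolated vertex is both a source and a sink.\<close>

definition is_source :: "('v, 'm) wo_graph_scheme \<Rightarrow> 'v \<Rightarrow> bool" where
  "is_source D x \<longleftrightarrow> x \<in> verts D \<and> (\<forall>y. (y, x) \<notin> edges D)"

definition is_sink :: "('v, 'm) wo_graph_scheme \<Rightarrow> 'v \<Rightarrow> bool" where
  "is_sink D x \<longleftrightarrow> x \<in> verts D \<and> (\<forall>y. (x, y) \<notin> edges D)"

locale weighted_oriented_graph =
  fixes D :: "('v, 'm) wo_graph_scheme"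
  assumes finite_verts: "finite (verts D)"
    and edges_in_verts: "edges D \<subseteq> verts D \<times> verts D"
    and no_loops: "(x, x) \<notin> edges D"
    and one_orientation: "(x, y) \<in> edges D \<Longrightarrow> (y, x) \<notin> edges D"
    and weight_pos: "x \<in> verts D \<Longrightarrow> weight D x \<ge> 1"
    and weight_source: "is_source D x \<Longrightarrow> weight D x = 1"

definition nontrivial_verts :: "('v, 'm) wo_graph_scheme \<Rightarrow> 'v set" where
  "nontrivial_verts D = {x \<in> verts D. weight D x \<noteq> 1}"


section \<open>Polynomials with variables in a given set\<close>

text \<open>
  A monomial is a finitely supported exponent vector of type \<^typ>\<open>'v \<Rightarrow>\<^sub>0 nat\<close>, and a polynomial
  is a finitely supported coefficient function on monomials.
\<close>

type_synonym ('v, 'k) mpoly = "('v \<Rightarrow>\<^sub>0 nat) \<Rightarrow>\<^sub>0 'k"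

definition mpoly_ring :: "'v set \<Rightarrow> ('v, 'k::field) mpoly ring" where
  "mpoly_ring V =
    \<lparr>carrier = {p. \<forall>m \<in> Poly_Mapping.keys p. Poly_Mapping.keys m \<subseteq> V},
     mult = (*), one = 1, zero = 0, add = (+)\<rparr>"

definition var :: "'v \<Rightarrow> ('v, 'k::field) mpoly" where
  "var x = Poly_Mapping.single (Poly_Mapping.single x 1) 1"

definition edge_ideal :: "('v, 'm) wo_graph_scheme \<Rightarrow> ('v, 'k::field) mpoly set" where
  "edge_ideal D =
    Idl\<^bsub>mpoly_ring (verts D)\<^esub> {var x * var y ^ weight D y |x y. (x, y) \<in> edges D}"


section \<open>Localization at a multiplicative set\<close>

definition frac_rel :: "('a, 'm) ring_scheme \<Rightarrow> 'a set \<Rightarrow> (('a \<times> 'a) \<times> ('a \<times> 'a)) set" where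
  "frac_rel R S = {((a, s), (b, t)). a \<in> carrier R \<and> b \<in> carrier R \<and> s \<in> S \<and> t \<in> S \<and>
     (\<exists>u \<in> S. u \<otimes>\<^bsub>R\<^esub> (a \<otimes>\<^bsub>R\<^esub> t \<ominus>\<^bsub>R\<^esub> b \<otimes>\<^bsub>R\<^esub> s) = \<zero>\<^bsub>R\<^esub>)}"

definition frac :: "('a, 'm) ring_scheme \<Rightarrow> 'a set \<Rightarrow> 'a \<Rightarrow> 'a \<Rightarrow> ('a \<times> 'a) set" where
  "frac R S a s = frac_rel R S `` {(a, s)}"

text \<open>
  As for quotient rings in the library, the operations on classes are unions over all
  representatives.
\<close>

definition localization :: "('a, 'm) ring_scheme \<Rightarrow> 'a set \<Rightarrow> ('a \<times> 'a) set ring" where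
  "localization R S =
    \<lparr>carrier = (carrier R \<times> S) // frac_rel R S,
     mult = (\<lambda>X Y. \<Union>(a, s) \<in> X. \<Union>(b, t) \<in> Y. frac R S (a \<otimes>\<^bsub>R\<^esub> b) (s \<otimes>\<^bsub>R\<^esub> t)),
     one = frac R S \<one>\<^bsub>R\<^esub> \<one>\<^bsub>R\<^esub>,
     zero = frac R S \<zero>\<^bsub>R\<^esub> \<one>\<^bsub>R\<^esub>,
     add = (\<lambda>X Y. \<Union>(a, s) \<in> X. \<Union>(b, t) \<in> Y.
              frac R S (a \<otimes>\<^bsub>R\<^esub> t \<oplus>\<^bsub>R\<^esub> b \<otimes>\<^bsub>R\<^esub> s) (s \<otimes>\<^bsub>R\<^esub> t))\<rparr>"

text \<open>The ideal \<open>J R\<^sub>P \<inter> R\<close>, where \<open>R\<^sub>P\<close> is the localization at the complement of \<open>P\<close>.\<close>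

definition local_contraction :: "('a, 'm) ring_scheme \<Rightarrow> 'a set \<Rightarrow> 'a set \<Rightarrow> 'a set" where
  "local_contraction R P J =
    {f \<in> carrier R. frac R (carrier R - P) f \<one>\<^bsub>R\<^esub>
       \<in> Idl\<^bsub>localization R (carrier R - P)\<^esub> ((\<lambda>g. frac R (carrier R - P) g \<one>\<^bsub>R\<^esub>) ` J)}"


section \<open>Associated primes and symbolic powers\<close>

text \<open>
  The associated primes of the module \<open>R/I\<close>: prime ideals that are annihilators of an
  element of \<open>R/I\<close>, on which \<open>r \<in> R\<close> acts as multiplication by its residue class.
\<close>

definition assoc_primes :: "('a, 'm) ring_scheme \<Rightarrow> 'a set \<Rightarrow> 'a set set" where
  "assoc_primes R I = {P. primeideal P R \<and>
     (\<exists>m \<in> carrier (R Quot I).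
        P = {r \<in> carrier R. (I +>\<^bsub>R\<^esub> r) \<otimes>\<^bsub>R Quot I\<^esub> m = \<zero>\<^bsub>R Quot I\<^esub>})}"

definition ideal_power :: "('a, 'm) ring_scheme \<Rightarrow> 'a set \<Rightarrow> nat \<Rightarrow> 'a set" where
  "ideal_power R I s = I [^]\<^bsub>ideals_set R\<^esub> s"

text \<open>Intersecting with the carrier makes an empty intersection equal to the whole ring.\<close>

definition symbolic_power :: "('a, 'm) ring_scheme \<Rightarrow> 'a set \<Rightarrow> nat \<Rightarrow> 'a set" where
  "symbolic_power R I s =
    carrier R \<inter> (\<Inter>P \<in> assoc_primes R I. local_contraction R P (ideal_power R I s))"

end

theory Submission
  imports Defs "HOL-Library.Set_Algebras"
begin

text \<open>
  A vertex of \<open>U\<close> occurs in the generators of \<open>I\<close> only with exponent equal to its weight, so \<open>I\<close> is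
  the extension of \<open>I'\<close> along the substitution \<open>x \<mapsto> x ^ c x\<close>, where \<open>c\<close> is the weight on \<open>U\<close> and 1
  elsewhere. On exponent vectors this says that \<open>m\<close> lies in \<open>I\<close> iff \<open>\<lfloor>m / c\<rfloor>\<close> lies in \<open>I'\<close>. For
  monomial ideals, powers, associated primes and contractions from localizations can all be described
  on exponent vectors, and each of these descriptions commutes with taking preimages under the
  surjection \<open>m \<mapsto> \<lfloor>m / c\<rfloor>\<close>. Hence the symbolic and ordinary powers of \<open>I\<close> are the preimages of
  those of \<open>I'\<close>, and one pair coincides iff the other does.
\<close>

section \<open>Localization at a multiplicative set\<close>

lemma (in abelian_group) a_minus_eq_zero_iff:
  "x \<in> carrier G \<Longrightarrow> y \<in> carrier G \<Longrightarrow> x \<ominus> y = \<zero> \<longleftrightarrow> x = y"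
  by (metis a_minus_def minus_equality minus_minus r_neg a_inv_closed)

lemma (in cring) ideal_cringI:
  assumes "K \<subseteq> carrier R" "\<zero> \<in> K"
    and add: "\<And>x y. x \<in> K \<Longrightarrow> y \<in> K \<Longrightarrow> x \<oplus> y \<in> K"
    and mult: "\<And>r x. r \<in> carrier R \<Longrightarrow> x \<in> K \<Longrightarrow> r \<otimes> x \<in> K"
  shows "ideal K R"
proof (rule idealI)
  show "ring R" ..
  have "\<ominus> x \<in> K" if "x \<in> K" for x
    using mult[of "\<ominus> \<one>" x] that assms(1) by (auto simp: l_minus)
  then show "subgroup K (add_monoid R)"
    using assms by (intro subgroup.intro) (auto simp flip: a_inv_def)
  show "r \<otimes> x \<in> K" if "x \<in> K" "r \<in> carrier R" for r x
    using mult that by blast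
  then show "x \<otimes> r \<in> K" if "x \<in> K" "r \<in> carrier R" for r x
    using that assms(1) m_comm by (metis subsetD)
qed

locale multiplicative_set = cring R + S: submonoid S R for R (structure) and S
begin

lemma frac_rel_iff:
  "((a, s), (b, t)) \<in> frac_rel R S \<longleftrightarrow>
    a \<in> carrier R \<and> b \<in> carrier R \<and> s \<in> S \<and> t \<in> S \<and> (\<exists>u\<in>S. u \<otimes> a \<otimes> t = u \<otimes> b \<otimes> s)"
proof -
  have "u \<otimes> (a \<otimes> t \<ominus> b \<otimes> s) = \<zero> \<longleftrightarrow> u \<otimes> a \<otimes> t = u \<otimes> b \<otimes> s"
    if "a \<in> carrier R" "b \<in> carrier R" "s \<in> S" "t \<in> S" "u \<in> S" for u
  proof -
    have "u \<otimes> (a \<otimes> t \<ominus> b \<otimes> s) = u \<otimes> a \<otimes> t \<ominus> u \<otimes> b \<otimes> s"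
      using that S.mem_carrier by algebra
    then show ?thesis
      using that by (simp add: a_minus_eq_zero_iff)
  qed
  then show ?thesis
    unfolding frac_rel_def by blast
qed

lemma frac_relE:
  assumes "((a, s), (b, t)) \<in> frac_rel R S"
  obtains u where "u \<in> S" "u \<in> carrier R" "u \<otimes> a \<otimes> t = u \<otimes> b \<otimes> s"
    and "a \<in> carrier R" "b \<in> carrier R" "s \<in> S" "t \<in> S" "s \<in> carrier R" "t \<in> carrier R"
  using assms by (auto simp: frac_rel_iff)

lemma trans_frac_rel: "trans (frac_rel R S)"
proof (rule transI, clarify)
  fix a s b t c r
  assume ab: "((a, s), (b, t)) \<in> frac_rel R S" and bc: "((b, t), (c, r)) \<in> frac_rel R S"
  obtain u where u: "u \<in> S" "u \<in> carrier R" "u \<otimes> a \<otimes> t = u \<otimes> b \<otimes> s"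
    and ab_in: "a \<in> carrier R" "b \<in> carrier R" "s \<in> S" "t \<in> S" "s \<in> carrier R" "t \<in> carrier R"
    using ab by (rule frac_relE)
  obtain v where v: "v \<in> S" "v \<in> carrier R" "v \<otimes> b \<otimes> r = v \<otimes> c \<otimes> t"
    and c_in: "c \<in> carrier R" "r \<in> S" "r \<in> carrier R"
    using bc by (rule frac_relE)
  note in_R = u(2) v(2) ab_in(1,2,5,6) c_in(1,3)
  have "(u \<otimes> v \<otimes> t) \<otimes> a \<otimes> r = (u \<otimes> a \<otimes> t) \<otimes> (v \<otimes> r)"
    using in_R by algebra
  also have "\<dots> = (v \<otimes> b \<otimes> r) \<otimes> (u \<otimes> s)"
    unfolding u(3) using in_R by algebra
  also have "\<dots> = (u \<otimes> v \<otimes> t) \<otimes> c \<otimes> s"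
    unfolding v(3) using in_R by algebra
  finally show "((a, s), (c, r)) \<in> frac_rel R S"
    unfolding frac_rel_iff using ab_in c_in u(1) v(1) by blast
qed

lemma equiv_frac_rel: "equiv (carrier R \<times> S) (frac_rel R S)"
proof (rule equivI)
  show "frac_rel R S \<subseteq> (carrier R \<times> S) \<times> (carrier R \<times> S)"
    unfolding frac_rel_def by blast
  show "refl_on (carrier R \<times> S) (frac_rel R S)"
    by (auto simp: refl_on_def frac_rel_iff)
  show "sym (frac_rel R S)"
    by (rule symI) (auto simp: frac_rel_iff, metis)
qed (rule trans_frac_rel)

lemma frac_eq_iff:
  assumes "a \<in> carrier R" "b \<in> carrier R" "s \<in> S" "t \<in> S"
  shows "frac R S a s = frac R S b t \<longleftrightarrow> (\<exists>u\<in>S. u \<otimes> a \<otimes> t = u \<otimes> b \<otimes> s)"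
  using eq_equiv_class_iff[OF equiv_frac_rel, of "(a, s)" "(b, t)"] assms
  by (simp add: frac_def frac_rel_iff)

lemma frac_eqI:
  assumes "a \<in> carrier R" "b \<in> carrier R" "s \<in> S" "t \<in> S" "a \<otimes> t = b \<otimes> s"
  shows "frac R S a s = frac R S b t"
  using assms by (auto simp: frac_eq_iff m_assoc intro!: bexI[of _ \<one>])

lemma frac_cancel:
  assumes "a \<in> carrier R" "s \<in> S" "r \<in> S"
  shows "frac R S (a \<otimes> r) (s \<otimes> r) = frac R S a s"
  using assms by (intro frac_eqI) (auto simp: m_ac)

lemma frac_closed [simp]:
  "a \<in> carrier R \<Longrightarrow> s \<in> S \<Longrightarrow> frac R S a s \<in> carrier (localization R S)"
  by (auto simp: localization_def frac_def quotient_def)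

lemma localization_carrierE:
  assumes "X \<in> carrier (localization R S)"
  obtains a s where "a \<in> carrier R" "s \<in> S" "X = frac R S a s"
  using assms by (auto simp: localization_def frac_def quotient_def)

lemma localization_one: "\<one>\<^bsub>localization R S\<^esub> = frac R S \<one> \<one>"
  and localization_zero: "\<zero>\<^bsub>localization R S\<^esub> = frac R S \<zero> \<one>"
  by (simp_all add: localization_def)

lemma frac_mult_respects: "(\<lambda>(a, s) (b, t). frac R S (a \<otimes> b) (s \<otimes> t)) respects2 frac_rel R S"
proof (rule congruent2_commuteI[OF equiv_frac_rel], clarsimp simp: m_comm, clarify)
  fix a s b t c r
  assume a: "a \<in> carrier R" "s \<in> S" and bc: "((b, t), (c, r)) \<in> frac_rel R S"
  obtain u where u: "u \<in> S" "u \<in> carrier R" "u \<otimes> b \<otimes> r = u \<otimes> c \<otimes> t"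
    and bc_in: "b \<in> carrier R" "c \<in> carrier R" "t \<in> S" "r \<in> S" "t \<in> carrier R" "r \<in> carrier R"
    using bc by (rule frac_relE)
  note in_R = a(1) a(2)[THEN S.mem_carrier] u(2) bc_in(1,2,5,6)
  have "u \<otimes> (a \<otimes> b) \<otimes> (s \<otimes> r) = (a \<otimes> s) \<otimes> (u \<otimes> b \<otimes> r)"
    using in_R by algebra
  also have "\<dots> = u \<otimes> (a \<otimes> c) \<otimes> (s \<otimes> t)"
    unfolding u(3) using in_R by algebra
  finally show "frac R S (a \<otimes> b) (s \<otimes> t) = frac R S (a \<otimes> c) (s \<otimes> r)"
    using a bc_in u(1) by (auto simp: frac_eq_iff)
qed

lemma frac_mult [simp]:
  assumes "a \<in> carrier R" "s \<in> S" "b \<in> carrier R" "t \<in> S"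
  shows "frac R S a s \<otimes>\<^bsub>localization R S\<^esub> frac R S b t = frac R S (a \<otimes> b) (s \<otimes> t)"
  using UN_equiv_class2[OF equiv_frac_rel equiv_frac_rel frac_mult_respects, of "(a, s)" "(b, t)"]
    assms
  by (simp add: localization_def frac_def split_beta)

lemma frac_add_respects:
  "(\<lambda>(a, s) (b, t). frac R S (a \<otimes> t \<oplus> b \<otimes> s) (s \<otimes> t)) respects2 frac_rel R S"
proof (rule congruent2_commuteI[OF equiv_frac_rel], clarsimp simp: m_comm a_comm, clarify)
  fix a s b t c r
  assume a: "a \<in> carrier R" "s \<in> S" and bc: "((b, t), (c, r)) \<in> frac_rel R S"
  obtain u where u: "u \<in> S" "u \<in> carrier R" "u \<otimes> b \<otimes> r = u \<otimes> c \<otimes> t"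
    and bc_in: "b \<in> carrier R" "c \<in> carrier R" "t \<in> S" "r \<in> S" "t \<in> carrier R" "r \<in> carrier R"
    using bc by (rule frac_relE)
  note in_R = a(1) a(2)[THEN S.mem_carrier] u(2) bc_in(1,2,5,6)
  have "u \<otimes> (a \<otimes> t \<oplus> b \<otimes> s) \<otimes> (s \<otimes> r) = u \<otimes> a \<otimes> t \<otimes> s \<otimes> r \<oplus> (u \<otimes> b \<otimes> r) \<otimes> (s \<otimes> s)"
    using in_R by algebra
  also have "\<dots> = u \<otimes> (a \<otimes> r \<oplus> c \<otimes> s) \<otimes> (s \<otimes> t)"
    unfolding u(3) using in_R by algebra
  finally show "frac R S (a \<otimes> t \<oplus> b \<otimes> s) (s \<otimes> t) = frac R S (a \<otimes> r \<oplus> c \<otimes> s) (s \<otimes> r)"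
    using a bc_in u(1) by (auto simp: frac_eq_iff)
qed

lemma frac_add [simp]:
  assumes "a \<in> carrier R" "s \<in> S" "b \<in> carrier R" "t \<in> S"
  shows "frac R S a s \<oplus>\<^bsub>localization R S\<^esub> frac R S b t =
    frac R S (a \<otimes> t \<oplus> b \<otimes> s) (s \<otimes> t)"
  using UN_equiv_class2[OF equiv_frac_rel equiv_frac_rel frac_add_respects, of "(a, s)" "(b, t)"]
    assms
  by (simp add: localization_def frac_def split_beta)

lemma abelian_group_localization: "abelian_group (localization R S)"
proof (rule abelian_groupI)
  let ?L = "localization R S"
  fix x y z
  assume "x \<in> carrier ?L" "y \<in> carrier ?L" "z \<in> carrier ?L"
  then obtain a s b t c r where abc: "a \<in> carrier R" "b \<in> carrier R" "c \<in> carrier R"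
    and str: "s \<in> S" "t \<in> S" "r \<in> S"
    and xyz: "x = frac R S a s" "y = frac R S b t" "z = frac R S c r"
    by (elim localization_carrierE)
  have "(a \<otimes> t \<oplus> b \<otimes> s) \<otimes> r \<oplus> c \<otimes> (s \<otimes> t) = a \<otimes> (t \<otimes> r) \<oplus> (b \<otimes> r \<oplus> c \<otimes> t) \<otimes> s"
    using abc str[THEN S.mem_carrier] by algebra
  then show "x \<oplus>\<^bsub>?L\<^esub> y \<oplus>\<^bsub>?L\<^esub> z = x \<oplus>\<^bsub>?L\<^esub> (y \<oplus>\<^bsub>?L\<^esub> z)"
    using abc str xyz by (simp add: m_assoc)
next
  let ?L = "localization R S"
  fix x assume "x \<in> carrier ?L"
  then obtain a s where as: "a \<in> carrier R" "s \<in> S" "x = frac R S a s"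
    by (rule localization_carrierE)
  have "frac R S (\<ominus> a) s \<oplus>\<^bsub>?L\<^esub> x = frac R S (\<ominus> a \<otimes> s \<oplus> a \<otimes> s) (s \<otimes> s)"
    using as by simp
  also have "\<dots> = \<zero>\<^bsub>?L\<^esub>"
    unfolding localization_zero using as by (intro frac_eqI) (simp_all add: l_minus l_neg)
  finally show "\<exists>y\<in>carrier ?L. y \<oplus>\<^bsub>?L\<^esub> x = \<zero>\<^bsub>?L\<^esub>"
    using as by (intro bexI[of _ "frac R S (\<ominus> a) s"]) simp_all
qed (auto elim!: localization_carrierE simp: localization_zero m_comm a_comm)

lemma comm_monoid_localization: "comm_monoid (localization R S)"
  by (rule comm_monoidI) (auto elim!: localization_carrierE simp: localization_one m_ac)

lemma cring_localization: "cring (localization R S)"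
proof (rule cringI[OF abelian_group_localization comm_monoid_localization])
  let ?L = "localization R S"
  fix x y z
  assume "x \<in> carrier ?L" "y \<in> carrier ?L" "z \<in> carrier ?L"
  then obtain a s b t c r where abc: "a \<in> carrier R" "b \<in> carrier R" "c \<in> carrier R"
    and str: "s \<in> S" "t \<in> S" "r \<in> S"
    and xyz: "x = frac R S a s" "y = frac R S b t" "z = frac R S c r"
    by (elim localization_carrierE)
  have "(a \<otimes> t \<oplus> b \<otimes> s) \<otimes> c \<otimes> r = a \<otimes> c \<otimes> (t \<otimes> r) \<oplus> b \<otimes> c \<otimes> (s \<otimes> r)"
    "s \<otimes> t \<otimes> r \<otimes> r = s \<otimes> r \<otimes> (t \<otimes> r)"
    using abc str[THEN S.mem_carrier] by (simp_all add: l_distr r_distr m_ac)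
  then have "frac R S ((a \<otimes> t \<oplus> b \<otimes> s) \<otimes> c) (s \<otimes> t \<otimes> r) =
      frac R S (a \<otimes> c \<otimes> (t \<otimes> r) \<oplus> b \<otimes> c \<otimes> (s \<otimes> r)) (s \<otimes> r \<otimes> (t \<otimes> r))"
    using abc str frac_cancel[of "(a \<otimes> t \<oplus> b \<otimes> s) \<otimes> c" "s \<otimes> t \<otimes> r" r] by simp
  then show "(x \<oplus>\<^bsub>?L\<^esub> y) \<otimes>\<^bsub>?L\<^esub> z = x \<otimes>\<^bsub>?L\<^esub> z \<oplus>\<^bsub>?L\<^esub> y \<otimes>\<^bsub>?L\<^esub> z"
    using abc str xyz by simp
qed

lemma ideal_fractions:
  assumes "ideal J R"
  shows "ideal {frac R S a s |a s. a \<in> J \<and> s \<in> S} (localization R S)" (is "ideal ?K ?L")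
proof -
  interpret J: ideal J R by fact
  interpret L: cring ?L by (rule cring_localization)
  show ?thesis
  proof (rule L.ideal_cringI)
    show "\<zero>\<^bsub>?L\<^esub> \<in> ?K"
      by (intro CollectI exI[of _ \<zero>] exI[of _ \<one>]) (simp add: localization_zero)
    show "x \<oplus>\<^bsub>?L\<^esub> y \<in> ?K" if xy: "x \<in> ?K" "y \<in> ?K" for x y
    proof -
      obtain a s b t where "x = frac R S a s" "y = frac R S b t" "a \<in> J" "b \<in> J" "s \<in> S" "t \<in> S"
        using xy by blast
      moreover from this have "a \<otimes> t \<oplus> b \<otimes> s \<in> J"
        by (simp add: J.I_r_closed)
      ultimately show ?thesis
        by auto
    qed
    show "r \<otimes>\<^bsub>?L\<^esub> x \<in> ?K" if r: "r \<in> carrier ?L" and x: "x \<in> ?K" for r x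
    proof -
      obtain a s b t where "r = frac R S a s" "x = frac R S b t"
        "a \<in> carrier R" "b \<in> J" "s \<in> S" "t \<in> S"
        using r x by (blast elim: localization_carrierE)
      moreover from this have "a \<otimes> b \<in> J"
        by (simp add: J.I_l_closed)
      ultimately show ?thesis
        by auto
    qed
  qed auto
qed

lemma genideal_image_frac:
  assumes "ideal J R"
  shows "Idl\<^bsub>localization R S\<^esub> ((\<lambda>g. frac R S g \<one>) ` J) = {frac R S a s |a s. a \<in> J \<and> s \<in> S}"
    (is "?I = ?K")
proof
  let ?L = "localization R S"
  interpret J: ideal J R by fact
  interpret L: cring ?L by (rule cring_localization)
  have image: "(\<lambda>g. frac R S g \<one>) ` J \<subseteq> carrier ?L"
    by auto
  show "?I \<subseteq> ?K"
    by (rule L.genideal_minimal[OF ideal_fractions[OF assms]]) (use S.one_closed in blast)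
  interpret I: ideal ?I ?L
    by (rule L.genideal_ideal[OF image])
  show "?K \<subseteq> ?I"
  proof clarify
    fix a s assume as: "a \<in> J" "s \<in> S"
    then have "frac R S \<one> s \<otimes>\<^bsub>?L\<^esub> frac R S a \<one> \<in> ?I"
      using L.genideal_self[OF image] by (intro I.I_l_closed) auto
    then show "frac R S a s \<in> ?I"
      using as by simp
  qed
qed

end

definition saturation :: "('a, 'm) ring_scheme \<Rightarrow> 'a set \<Rightarrow> 'a set \<Rightarrow> 'a set" where
  "saturation R S J = {f \<in> carrier R. \<exists>u \<in> S. u \<otimes>\<^bsub>R\<^esub> f \<in> J}"

lemma (in multiplicative_set) frac_mem_genideal_iff:
  assumes "ideal J R" "f \<in> carrier R"
  shows "frac R S f \<one> \<in> Idl\<^bsub>localization R S\<^esub> ((\<lambda>g. frac R S g \<one>) ` J) \<longleftrightarrow> f \<in> saturation R S J"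
  unfolding genideal_image_frac[OF assms(1)]
proof
  interpret J: ideal J R by fact
  assume "frac R S f \<one> \<in> {frac R S a s |a s. a \<in> J \<and> s \<in> S}"
  then obtain a s u where a: "a \<in> J" "s \<in> S" "u \<in> S" "u \<otimes> f \<otimes> s = u \<otimes> a \<otimes> \<one>"
    using assms(2) by (auto simp: frac_eq_iff)
  have "(u \<otimes> s) \<otimes> f = u \<otimes> f \<otimes> s"
    using a assms(2) by (simp add: m_ac)
  also have "\<dots> \<in> J"
    using a by (simp add: J.I_l_closed)
  finally show "f \<in> saturation R S J"
    using a assms(2) by (auto simp: saturation_def)
next
  assume "f \<in> saturation R S J"
  then obtain u where u: "u \<in> S" "u \<otimes> f \<in> J"
    by (auto simp: saturation_def)
  have "frac R S f \<one> = frac R S (u \<otimes> f) u"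
    using u assms(2) by (intro frac_eqI) (simp_all add: m_comm)
  with u show "frac R S f \<one> \<in> {frac R S a s |a s. a \<in> J \<and> s \<in> S}"
    by blast
qed

lemma (in primeideal) multiplicative_set_compl: "multiplicative_set R (carrier R - I)"
proof
  show "\<one> \<in> carrier R - I"
    using I_notcarr one_imp_carrier by auto
  show "s \<otimes> t \<in> carrier R - I" if "s \<in> carrier R - I" "t \<in> carrier R - I" for s t
    using that I_prime by auto
qed auto

lemma local_contraction_eq_saturation:
  fixes R (structure)
  assumes "primeideal P R" "ideal J R"
  shows "local_contraction R P J = saturation R (carrier R - P) J"
proof -
  interpret multiplicative_set R "carrier R - P"
    using assms(1) by (rule primeideal.multiplicative_set_compl)
  show ?thesis
    unfolding local_contraction_def using frac_mem_genideal_iff[OF assms(2)]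
    by (auto simp: saturation_def)
qed


section \<open>Monomial ideals\<close>

abbreviation keys where "keys \<equiv> Poly_Mapping.keys"
abbreviation lookup where "lookup \<equiv> Poly_Mapping.lookup"
abbreviation single where "single \<equiv> Poly_Mapping.single"

definition exponents :: "'v set \<Rightarrow> ('v \<Rightarrow>\<^sub>0 nat) set" where
  "exponents V = {m. keys m \<subseteq> V}"

definition monomial_span :: "'a set \<Rightarrow> ('a \<Rightarrow>\<^sub>0 'k::zero) set" where
  "monomial_span E = {f. keys f \<subseteq> E}"

lemma keys_add_nat: "keys (m + n) = keys m \<union> keys n" for m n :: "'v \<Rightarrow>\<^sub>0 nat"
  by (auto simp: in_keys_iff lookup_add)

lemma add_in_exponents_iff [simp]: "m + n \<in> exponents V \<longleftrightarrow> m \<in> exponents V \<and> n \<in> exponents V"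
  by (simp add: exponents_def keys_add_nat)

lemma zero_in_exponents [simp]: "0 \<in> exponents V"
  by (simp add: exponents_def)

lemma single_in_exponents [simp]: "v \<in> V \<Longrightarrow> single v k \<in> exponents V"
  by (simp add: exponents_def)

lemma exponents_Diff_subset: "m \<in> exponents (V - A) \<Longrightarrow> m \<in> exponents V"
  by (auto simp: exponents_def)

lemma exponent_induct [case_names zero add]:
  assumes "P 0" "\<And>v m. P m \<Longrightarrow> P (single v 1 + m)"
  shows "P (m :: 'v \<Rightarrow>\<^sub>0 nat)"
proof (induction m rule: update_induct)
  case (update m v k)
  have "P (single v k + m)"
  proof (induction k)
    case (Suc k)
    have "single v (Suc k) + m = single v 1 + (single v k + m)"
      by (simp flip: add.assoc single_add)
    then show ?case
      using assms(2)[OF Suc] by simp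
  qed (simp add: update.IH)
  moreover have "Poly_Mapping.update v k m = single v k + m"
    using update.hyps
    by (intro poly_mapping_eqI)
      (auto simp: lookup_update lookup_add lookup_single in_keys_iff when_def)
  ultimately show ?case
    by simp
qed (rule assms(1))

lemma sum_single_lookup: "(\<Sum>m\<in>keys f. single m (lookup f m)) = f"
  by (rule poly_mapping_eqI) (auto simp: lookup_sum lookup_single when_def in_keys_iff)

lemma lookup_times_unique:
  fixes f g :: "'a::comm_monoid_add \<Rightarrow>\<^sub>0 'k::comm_semiring_1"
  assumes "\<And>p' q'. \<lbrakk>p' \<in> keys f; q' \<in> keys g; p' + q' = p + q\<rbrakk> \<Longrightarrow> p' = p \<and> q' = q"
  shows "lookup (f * g) (p + q) = lookup f p * lookup g q"
proof -
  have "f * g = (\<Sum>p'\<in>keys f. single p' (lookup f p')) * (\<Sum>q'\<in>keys g. single q' (lookup g q'))"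
    by (simp add: sum_single_lookup)
  also have "\<dots> = (\<Sum>p'\<in>keys f. \<Sum>q'\<in>keys g. single (p' + q') (lookup f p' * lookup g q'))"
    by (simp add: sum_product mult_single)
  finally have "lookup (f * g) (p + q) =
      (\<Sum>p'\<in>keys f. \<Sum>q'\<in>keys g. if p' + q' = p + q then lookup f p' * lookup g q' else 0)"
    by (simp add: lookup_sum lookup_single when_def)
  also have "\<dots> = (\<Sum>p'\<in>keys f. \<Sum>q'\<in>keys g.
      if q' = q then if p' = p then lookup f p * lookup g q else 0 else 0)"
    by (intro sum.cong refl) (use assms in auto)
  also have "\<dots> = lookup f p * lookup g q"
    by (cases "lookup g q = 0") (simp_all add: in_keys_iff)
  finally show ?thesis .
qed

lemma keys_single_times:
  fixes f :: "'a::cancel_comm_monoid_add \<Rightarrow>\<^sub>0 'k::comm_semiring_1"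
  shows "keys (single m 1 * f) = (+) m ` keys f"
proof
  show "keys (single m 1 * f) \<subseteq> (+) m ` keys f"
    using keys_mult[of "single m 1" f] by auto
  have "lookup (single m 1 * f) (m + n) = lookup f n" for n
    using lookup_times_unique[of "single m 1" f m n] by simp
  then show "(+) m ` keys f \<subseteq> keys (single m 1 * f)"
    by (auto simp: in_keys_iff)
qed

lemma mpoly_ring_simps [simp]:
  "carrier (mpoly_ring V) = monomial_span (exponents V)"
  "mult (mpoly_ring V) = (*)" "one (mpoly_ring V) = 1"
  "zero (mpoly_ring V) = 0" "add (mpoly_ring V) = (+)"
  by (auto simp: mpoly_ring_def monomial_span_def exponents_def)

lemma monomial_span_zero [simp]: "0 \<in> monomial_span E"
  by (simp add: monomial_span_def)

lemma monomial_span_single: "m \<in> E \<Longrightarrow> single m c \<in> monomial_span E"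
  by (simp add: monomial_span_def)

lemma monomial_span_add:
  "f \<in> monomial_span E \<Longrightarrow> g \<in> monomial_span E \<Longrightarrow> f + g \<in> monomial_span E"
  using keys_add[of f g] by (auto simp: monomial_span_def)

lemma monomial_span_uminus: "f \<in> monomial_span E \<Longrightarrow> - f \<in> monomial_span E"
  for f :: "'a \<Rightarrow>\<^sub>0 'k::ab_group_add"
  by (auto simp: monomial_span_def in_keys_iff)

lemma monomial_span_mult:
  "f \<in> monomial_span E \<Longrightarrow> g \<in> monomial_span F \<Longrightarrow> f * g \<in> monomial_span (E + F)"
  using keys_mult[of f g] by (fastforce simp: monomial_span_def)

lemma monomial_span_mono: "E \<subseteq> F \<Longrightarrow> monomial_span E \<subseteq> monomial_span F"
  by (auto simp: monomial_span_def)

lemma monomial_span_eq_iff: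
  "(monomial_span E :: ('a \<Rightarrow>\<^sub>0 'k::zero_neq_one) set) = monomial_span F \<longleftrightarrow> E = F"
proof
  assume "(monomial_span E :: ('a \<Rightarrow>\<^sub>0 'k) set) = monomial_span F"
  then have "single m (1::'k) \<in> monomial_span E \<longleftrightarrow> single m (1::'k) \<in> monomial_span F" for m
    by simp
  then show "E = F"
    by (auto simp: monomial_span_def)
qed simp

lemma exponents_add_exponents: "exponents V + exponents V = exponents V"
  by (force simp: set_plus_def)

lemma cring_mpoly_ring: "cring (mpoly_ring V :: ('v, 'k::field) mpoly ring)"
proof (rule cringI)
  show "abelian_group (mpoly_ring V :: ('v, 'k) mpoly ring)"
  proof (rule abelian_groupI)
    show "\<exists>y\<in>carrier (mpoly_ring V). y \<oplus>\<^bsub>mpoly_ring V\<^esub> x = \<zero>\<^bsub>mpoly_ring V\<^esub>"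
      if "x \<in> carrier (mpoly_ring V)" for x :: "('v, 'k) mpoly"
      using that monomial_span_uminus[of x] by (intro bexI[of _ "- x"]) auto
  qed (auto simp: monomial_span_add add_ac)
  show "comm_monoid (mpoly_ring V :: ('v, 'k) mpoly ring)"
  proof (rule comm_monoidI)
    show "x \<otimes>\<^bsub>mpoly_ring V\<^esub> y \<in> carrier (mpoly_ring V)"
      if "x \<in> carrier (mpoly_ring V)" "y \<in> carrier (mpoly_ring V)" for x y :: "('v, 'k) mpoly"
      using that monomial_span_mult[of x "exponents V" y "exponents V"]
      by (simp add: exponents_add_exponents)
  qed (auto simp: mult_ac monomial_span_def)
qed (auto simp: algebra_simps)

definition exponent_ideal :: "'v set \<Rightarrow> ('v \<Rightarrow>\<^sub>0 nat) set \<Rightarrow> bool" where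
  "exponent_ideal V E \<longleftrightarrow> E \<subseteq> exponents V \<and> exponents V + E \<subseteq> E"

lemma exponent_idealI:
  assumes "E \<subseteq> exponents V" "\<And>m n. m \<in> E \<Longrightarrow> n \<in> exponents V \<Longrightarrow> n + m \<in> E"
  shows "exponent_ideal V E"
  using assms by (auto simp: exponent_ideal_def set_plus_def)

lemma exponent_idealD:
  assumes "exponent_ideal V E"
  shows "E \<subseteq> exponents V" "m \<in> E \<Longrightarrow> m \<in> exponents V"
    and "m \<in> E \<Longrightarrow> n \<in> exponents V \<Longrightarrow> n + m \<in> E"
  using assms by (auto simp: exponent_ideal_def)

lemma exponent_ideal_exponents: "exponent_ideal V (exponents V)"
  by (simp add: exponent_ideal_def exponents_add_exponents)

lemma exponent_ideal_set_plus:
  assumes "exponent_ideal V E" "F \<subseteq> exponents V"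
  shows "exponent_ideal V (E + F)"
proof (rule exponent_idealI)
  show "E + F \<subseteq> exponents V"
    using assms exponent_idealD(2)[OF assms(1)] by (auto simp: set_plus_def)
  fix k n assume "k \<in> E + F" "n \<in> exponents V"
  then obtain a b where "k = a + b" "n + a \<in> E" "b \<in> F"
    using exponent_idealD(3)[OF assms(1)] by (auto elim!: set_plus_elim)
  then show "n + k \<in> E + F"
    by (auto simp flip: add.assoc)
qed

lemma ideal_monomial_span:
  assumes "exponent_ideal V E"
  shows "ideal (monomial_span E :: ('v, 'k::field) mpoly set) (mpoly_ring V)"
proof (rule cring.ideal_cringI[OF cring_mpoly_ring])
  show "monomial_span E \<subseteq> (carrier (mpoly_ring V) :: ('v, 'k) mpoly set)"
    using exponent_idealD(1)[OF assms] by (simp add: monomial_span_mono)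
  show "r \<otimes>\<^bsub>mpoly_ring V\<^esub> f \<in> monomial_span E"
    if "r \<in> carrier (mpoly_ring V)" "f \<in> monomial_span E" for r f :: "('v, 'k) mpoly"
    using that assms monomial_span_mult[of r "exponents V" f E]
      monomial_span_mono[of "exponents V + E" E]
    by (auto simp: exponent_ideal_def)
qed (simp_all add: monomial_span_add)

lemma monomial_span_subset_ideal:
  fixes J :: "('v, 'k::field) mpoly set"
  assumes "ideal J (mpoly_ring V)" "\<And>m c. m \<in> E \<Longrightarrow> single m c \<in> J"
  shows "monomial_span E \<subseteq> J"
proof
  interpret J: additive_subgroup J "mpoly_ring V"
    using assms(1) by (rule ideal.axioms)
  have sum_in: "sum h M \<in> J" if "\<And>m. m \<in> M \<Longrightarrow> h m \<in> J"
    for M :: "('v \<Rightarrow>\<^sub>0 nat) set" and h :: "('v \<Rightarrow>\<^sub>0 nat) \<Rightarrow> ('v, 'k) mpoly"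
    using that J.a_closed J.zero_closed by (induction M rule: infinite_finite_induct) auto
  fix f :: "('v, 'k) mpoly" assume "f \<in> monomial_span E"
  then have "(\<Sum>m\<in>keys f. single m (lookup f m)) \<in> J"
    using assms(2) by (intro sum_in) (auto simp: monomial_span_def)
  then show "f \<in> J"
    by (simp add: sum_single_lookup)
qed

lemma ideal_prod_monomial_span:
  assumes "exponent_ideal V E" "exponent_ideal V F"
  shows "ideal_prod (mpoly_ring V) (monomial_span E) (monomial_span F) =
    (monomial_span (E + F) :: ('v, 'k::field) mpoly set)" (is "?P = _")
proof
  show "?P \<subseteq> monomial_span (E + F)"
  proof
    fix f assume "f \<in> ?P"
    then show "f \<in> monomial_span (E + F)"
      by induction (simp_all add: monomial_span_mult monomial_span_add)
  qed
  show "monomial_span (E + F) \<subseteq> ?P"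
  proof (rule monomial_span_subset_ideal)
    show "ideal ?P (mpoly_ring V)"
      using assms
      by (intro ring.ideal_prod_is_ideal cring.axioms[OF cring_mpoly_ring] ideal_monomial_span)
    fix m and c :: 'k assume "m \<in> E + F"
    then obtain a b where "m = a + b" "a \<in> E" "b \<in> F"
      by (rule set_plus_elim)
    then show "single m c \<in> ?P"
      using ideal_prod.prod[of "single a c" "monomial_span E" "single b 1" "monomial_span F"
          "mpoly_ring V"]
      by (simp add: monomial_span_single mult_single)
  qed
qed

primrec exponent_power :: "'v set \<Rightarrow> ('v \<Rightarrow>\<^sub>0 nat) set \<Rightarrow> nat \<Rightarrow> ('v \<Rightarrow>\<^sub>0 nat) set" where
  "exponent_power V E 0 = exponents V"
| "exponent_power V E (Suc s) = exponent_power V E s + E"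

lemma exponent_ideal_exponent_power:
  "exponent_ideal V E \<Longrightarrow> exponent_ideal V (exponent_power V E s)"
  by (induction s)
    (simp_all add: exponent_ideal_exponents exponent_ideal_set_plus exponent_idealD(1))

lemma ideal_power_monomial_span:
  assumes "exponent_ideal V E"
  shows "ideal_power (mpoly_ring V) (monomial_span E) s =
    (monomial_span (exponent_power V E s) :: ('v, 'k::field) mpoly set)"
proof (induction s)
  case 0
  then show ?case
    by (simp add: ideal_power_def nat_pow_def ideals_set_def)
next
  case (Suc s)
  have "ideal_power (mpoly_ring V) (monomial_span E) (Suc s) = ideal_prod (mpoly_ring V)
      (ideal_power (mpoly_ring V) (monomial_span E) s) (monomial_span E :: ('v, 'k) mpoly set)"
    by (simp add: ideal_power_def nat_pow_def ideals_set_def)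
  then show ?case
    using Suc ideal_prod_monomial_span[OF exponent_ideal_exponent_power[OF assms] assms] by simp
qed

lemma genideal_monomials:
  assumes "G \<subseteq> exponents V"
  shows "Idl\<^bsub>mpoly_ring V\<^esub> ((\<lambda>g. single g 1) ` G) =
    (monomial_span (exponents V + G) :: ('v, 'k::field) mpoly set)" (is "?I = _")
proof
  interpret cring "mpoly_ring V :: ('v, 'k) mpoly ring" by (rule cring_mpoly_ring)
  have gens: "(\<lambda>g. single g 1) ` G \<subseteq> (carrier (mpoly_ring V) :: ('v, 'k) mpoly set)"
    using assms by (auto simp: monomial_span_single)
  have "0 + g \<in> exponents V + G" if "g \<in> G" for g
    using that by (intro set_plus_intro) simp_all
  then show "?I \<subseteq> monomial_span (exponents V + G)"
    using assms exponent_ideal_exponents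
    by (intro genideal_minimal ideal_monomial_span exponent_ideal_set_plus)
      (auto simp: monomial_span_single)
  interpret I: ideal ?I "mpoly_ring V"
    by (rule genideal_ideal[OF gens])
  show "monomial_span (exponents V + G) \<subseteq> ?I"
  proof (rule monomial_span_subset_ideal[OF I.ideal_axioms])
    fix m and c :: 'k assume "m \<in> exponents V + G"
    then obtain n g where m: "m = n + g" "n \<in> exponents V" "g \<in> G"
      by (rule set_plus_elim)
    then have "single n c * single g 1 \<in> ?I"
      using genideal_self[OF gens] I.I_l_closed[of "single g 1" "single n c"]
      by (auto simp: monomial_span_single)
    with m show "single m c \<in> ?I"
      by (simp add: mult_single)
  qed
qed


section \<open>Associated primes of monomial ideals\<close>

text \<open>Numbering the variables turns the order of the exponent vectors over \<open>nat\<close> into a monomial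
  order.\<close>

lemma ex_additive_inj_on_exponents:
  assumes "finite V"
  obtains \<kappa> :: "('v \<Rightarrow>\<^sub>0 nat) \<Rightarrow> (nat \<Rightarrow>\<^sub>0 nat)"
  where "\<And>m n. \<kappa> (m + n) = \<kappa> m + \<kappa> n" "inj_on \<kappa> (exponents V)"
proof -
  obtain index :: "'v \<Rightarrow> nat" where index: "inj_on index V"
    using finite_imp_inj_to_nat_seg[OF assms] by blast
  define \<kappa> :: "('v \<Rightarrow>\<^sub>0 nat) \<Rightarrow> (nat \<Rightarrow>\<^sub>0 nat)" where
    "\<kappa> m = (\<Sum>v\<in>V. single (index v) (lookup m v))" for m
  have lookup_\<kappa>: "lookup (\<kappa> m) (index v) = lookup m v" if "v \<in> V" for m v
  proof -
    have "lookup (\<kappa> m) (index v) = (\<Sum>w\<in>V. if w = v then lookup m w else 0)"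
      unfolding \<kappa>_def lookup_sum using index that
      by (intro sum.cong) (auto simp: lookup_single when_def inj_on_eq_iff)
    then show ?thesis
      using that assms by simp
  qed
  show thesis
  proof
    show "\<kappa> (m + n) = \<kappa> m + \<kappa> n" for m n
      by (simp add: \<kappa>_def lookup_add single_add sum.distrib)
    show "inj_on \<kappa> (exponents V)"
    proof (intro inj_onI poly_mapping_eqI)
      fix m n v assume mn: "m \<in> exponents V" "n \<in> exponents V" "\<kappa> m = \<kappa> n"
      show "lookup m v = lookup n v"
      proof (cases "v \<in> V")
        case True
        then show ?thesis
          using mn(3) lookup_\<kappa>[of v] by metis
      next
        case False
        then show ?thesis
          using mn(1,2) by (metis exponents_def in_keys_iff mem_Collect_eq subsetD)
      qed
    qed
  qed
qed

lemma ex_unique_sum: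
  fixes X Y :: "('v \<Rightarrow>\<^sub>0 nat) set"
  assumes "finite X" "X \<noteq> {}" "finite Y" "Y \<noteq> {}"
  obtains p q where "p \<in> X" "q \<in> Y"
    and "\<And>p' q'. \<lbrakk>p' \<in> X; q' \<in> Y; p' + q' = p + q\<rbrakk> \<Longrightarrow> p' = p \<and> q' = q"
proof -
  define V where "V = \<Union> (keys ` (X \<union> Y))"
  have "finite V" and XY: "X \<subseteq> exponents V" "Y \<subseteq> exponents V"
    using assms by (auto simp: V_def exponents_def)
  then obtain \<kappa> :: "('v \<Rightarrow>\<^sub>0 nat) \<Rightarrow> (nat \<Rightarrow>\<^sub>0 nat)"
    where \<kappa>_add: "\<And>m n. \<kappa> (m + n) = \<kappa> m + \<kappa> n" and \<kappa>_inj: "inj_on \<kappa> (exponents V)"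
    using ex_additive_inj_on_exponents[of V] by blast
  have "Min (\<kappa> ` X) \<in> \<kappa> ` X" "Min (\<kappa> ` Y) \<in> \<kappa> ` Y"
    using assms by simp_all
  then obtain p q where pq: "p \<in> X" "q \<in> Y" "\<kappa> p = Min (\<kappa> ` X)" "\<kappa> q = Min (\<kappa> ` Y)"
    by auto
  have "p' = p \<and> q' = q" if "p' \<in> X" "q' \<in> Y" "p' + q' = p + q" for p' q'
  proof -
    have "\<kappa> p \<le> \<kappa> p'" "\<kappa> q \<le> \<kappa> q'"
      using pq that assms by simp_all
    moreover have "\<kappa> p' + \<kappa> q' = \<kappa> p + \<kappa> q"
      using that \<kappa>_add by metis
    ultimately have "\<kappa> p' = \<kappa> p" "\<kappa> q' = \<kappa> q"
      by (metis add_less_le_mono add_le_less_mono order.strict_iff_order order.irrefl)+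
    then show ?thesis
      using \<kappa>_inj that(1,2) pq(1,2) XY by (meson inj_onD subsetD)
  qed
  with pq show ?thesis
    using that by blast
qed

lemma ex_add_mem_keys_times:
  fixes f g :: "('v \<Rightarrow>\<^sub>0 nat) \<Rightarrow>\<^sub>0 'k::idom"
  assumes X: "X \<subseteq> keys f" "X \<noteq> {}" and Y: "Y \<subseteq> keys g" "Y \<noteq> {}"
    and XY: "\<And>p q p' q'. \<lbrakk>p \<in> X; q \<in> Y; p' \<in> keys f; q' \<in> keys g; p' + q' = p + q\<rbrakk>
      \<Longrightarrow> p' \<in> X \<and> q' \<in> Y"
  obtains p q where "p \<in> X" "q \<in> Y" "p + q \<in> keys (f * g)"
proof -
  have "finite X" "finite Y"
    using X Y by (auto intro: finite_subset[OF _ finite_keys])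
  then obtain p q where pq: "p \<in> X" "q \<in> Y"
    and unique: "\<And>p' q'. \<lbrakk>p' \<in> X; q' \<in> Y; p' + q' = p + q\<rbrakk> \<Longrightarrow> p' = p \<and> q' = q"
    using ex_unique_sum[of X Y] X Y by metis
  have "lookup (f * g) (p + q) = lookup f p * lookup g q"
    using XY[OF pq] unique by (intro lookup_times_unique) blast
  then have "p + q \<in> keys (f * g)"
    using pq X(1) Y(1) by (auto simp: in_keys_iff)
  with pq show ?thesis
    by (rule that)
qed

text \<open>The prime generated by the variables in \<open>A\<close>.\<close>

definition monomial_prime :: "'v set \<Rightarrow> 'v set \<Rightarrow> ('v, 'k::field) mpoly set" where
  "monomial_prime V A = monomial_span (exponents V - exponents (V - A))"

lemma mem_monomial_prime_iff:
  "f \<in> monomial_prime V A \<longleftrightarrow> f \<in> monomial_span (exponents V) \<and> keys f \<inter> exponents (V - A) = {}"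
  by (auto simp: monomial_prime_def monomial_span_def)

lemma primeideal_monomial_prime:
  "primeideal (monomial_prime V A :: ('v, 'k::field) mpoly set) (mpoly_ring V)"
proof (rule primeidealI)
  show "cring (mpoly_ring V :: ('v, 'k) mpoly ring)"
    by (rule cring_mpoly_ring)
  show "ideal (monomial_prime V A :: ('v, 'k) mpoly set) (mpoly_ring V)"
    unfolding monomial_prime_def by (rule ideal_monomial_span, rule exponent_idealI) auto
  have "(1 :: ('v, 'k) mpoly) \<in> carrier (mpoly_ring V)" "(1 :: ('v, 'k) mpoly) \<notin> monomial_prime V A"
    by (auto simp: mem_monomial_prime_iff monomial_span_def)
  then show "carrier (mpoly_ring V) \<noteq> (monomial_prime V A :: ('v, 'k) mpoly set)"
    by blast
  fix f g :: "('v, 'k) mpoly"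
  assume fg: "f \<in> carrier (mpoly_ring V)" "g \<in> carrier (mpoly_ring V)"
    and prod: "f \<otimes>\<^bsub>mpoly_ring V\<^esub> g \<in> monomial_prime V A"
  show "f \<in> monomial_prime V A \<or> g \<in> monomial_prime V A"
  proof (rule ccontr)
    let ?X = "keys f \<inter> exponents (V - A)" and ?Y = "keys g \<inter> exponents (V - A)"
    assume "\<not> ?thesis"
    then have "?X \<noteq> {}" "?Y \<noteq> {}"
      using fg by (auto simp: mem_monomial_prime_iff)
    moreover have "p' \<in> ?X \<and> q' \<in> ?Y"
      if "p \<in> ?X" "q \<in> ?Y" "p' \<in> keys f" "q' \<in> keys g" "p' + q' = p + q" for p q p' q'
      using that by (metis IntD2 IntI add_in_exponents_iff)
    ultimately obtain p q where "p \<in> ?X" "q \<in> ?Y" "p + q \<in> keys (f * g)"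
      using ex_add_mem_keys_times[of ?X f ?Y g] by blast
    then show False
      using prod by (auto simp: mem_monomial_prime_iff)
  qed
qed

lemma (in primeideal) mult_mem_iff:
  "a \<in> carrier R \<Longrightarrow> b \<in> carrier R \<Longrightarrow> a \<otimes> b \<in> I \<longleftrightarrow> a \<in> I \<or> b \<in> I"
  using I_prime[of a b] I_l_closed[of b a] I_r_closed[of a b] by blast

lemma single_add_mem_primeideal_iff:
  fixes P :: "('v, 'k::field) mpoly set"
  assumes "primeideal P (mpoly_ring V)" "m \<in> exponents V" "n \<in> exponents V"
  shows "single (m + n) 1 \<in> P \<longleftrightarrow> single m 1 \<in> P \<or> single n 1 \<in> P"
  using primeideal.mult_mem_iff[OF assms(1), of "single m 1" "single n 1"] assms(2,3)
  by (simp add: monomial_span_single mult_single)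

lemma monomial_mem_primeideal_iff:
  fixes P :: "('v, 'k::field) mpoly set"
  assumes P_prime: "primeideal P (mpoly_ring V)" and "m \<in> exponents V"
  shows "single m 1 \<in> P \<longleftrightarrow> (\<exists>v\<in>keys m. var v \<in> P)"
  using assms(2)
proof (induction m rule: exponent_induct)
  case zero
  interpret primeideal P "mpoly_ring V" by fact
  have "1 \<notin> P"
    using I_notcarr one_imp_carrier by auto
  then show ?case
    by simp
next
  case (add v m)
  then have "v \<in> V" "m \<in> exponents V"
    by (auto simp: exponents_def keys_add_nat)
  then show ?case
    using single_add_mem_primeideal_iff[OF P_prime, of "single v 1" m] add.IH
    by (simp add: keys_add_nat del: One_nat_def flip: var_def)
qed

lemma monomial_prime_subset_primeideal:
  fixes P :: "('v, 'k::field) mpoly set"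
  assumes P_prime: "primeideal P (mpoly_ring V)"
  shows "monomial_prime V {v \<in> V. var v \<in> P} \<subseteq> P"
  unfolding monomial_prime_def
proof (rule monomial_span_subset_ideal)
  interpret primeideal P "mpoly_ring V" by fact
  show "ideal P (mpoly_ring V)"
    by (rule ideal_axioms)
  fix m and c :: 'k assume "m \<in> exponents V - exponents (V - {v \<in> V. var v \<in> P})"
  then have "m \<in> exponents V" "\<exists>v\<in>keys m. var v \<in> P"
    by (auto simp: exponents_def)
  then have "single 0 c * single m 1 \<in> P"
    using monomial_mem_primeideal_iff[OF P_prime] I_l_closed[of "single m 1" "single 0 c"]
    by (simp add: monomial_span_single)
  then show "single m c \<in> P"
    by (simp add: mult_single)
qed

lemma mem_assoc_primes_iff:
  fixes R (structure)
  assumes "cring R" "ideal I R"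
  shows "P \<in> assoc_primes R I \<longleftrightarrow>
    primeideal P R \<and> (\<exists>f\<in>carrier R. P = {r \<in> carrier R. r \<otimes> f \<in> I})"
proof -
  interpret cring R by fact
  interpret I: ideal I R by fact
  have "(I +> r) \<otimes>\<^bsub>R Quot I\<^esub> (I +> f) = \<zero>\<^bsub>R Quot I\<^esub> \<longleftrightarrow> r \<otimes> f \<in> I"
    if "r \<in> carrier R" "f \<in> carrier R" for r f
  proof -
    have "(I +> r) \<otimes>\<^bsub>R Quot I\<^esub> (I +> f) = I +> (r \<otimes> f)" "\<zero>\<^bsub>R Quot I\<^esub> = I"
      using I.rcoset_mult_add[OF that] by (simp_all add: FactRing_def)
    then show ?thesis
      using I.a_rcos_const I.rcos_const_imp_mem m_closed[OF that] by metis
  qed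
  then have "{r \<in> carrier R. (I +> r) \<otimes>\<^bsub>R Quot I\<^esub> (I +> f) = \<zero>\<^bsub>R Quot I\<^esub>} =
      {r \<in> carrier R. r \<otimes> f \<in> I}" if "f \<in> carrier R" for f
    using that by blast
  moreover have "carrier (R Quot I) = (+>) I ` carrier R"
    by (auto simp: FactRing_simps)
  ultimately show ?thesis
    by (simp add: assoc_primes_def)
qed

definition associated_vars :: "'v set \<Rightarrow> ('v \<Rightarrow>\<^sub>0 nat) set \<Rightarrow> 'v set \<Rightarrow> bool" where
  "associated_vars V E A \<longleftrightarrow>
    A \<subseteq> V \<and> (\<exists>m\<in>exponents V. \<forall>n\<in>exponents V. n + m \<in> E \<longleftrightarrow> n \<notin> exponents (V - A))"

lemma monomial_prime_mem_assoc_primes: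
  assumes "exponent_ideal V E" "associated_vars V E A"
  shows "monomial_prime V A \<in>
    assoc_primes (mpoly_ring V) (monomial_span E :: ('v, 'k::field) mpoly set)"
proof -
  obtain m where m: "m \<in> exponents V"
    "\<And>n. n \<in> exponents V \<Longrightarrow> n + m \<in> E \<longleftrightarrow> n \<notin> exponents (V - A)"
    using assms(2) by (auto simp: associated_vars_def)
  have "r * single m 1 \<in> monomial_span E \<longleftrightarrow> r \<in> monomial_prime V A"
    if "r \<in> monomial_span (exponents V)" for r :: "('v, 'k) mpoly"
  proof -
    have "keys (r * single m 1) = (+) m ` keys r"
      using keys_single_times[of m r] by (simp add: mult.commute)
    with that m(2) show ?thesis
      by (auto simp: mem_monomial_prime_iff monomial_span_def add.commute[of m] subset_iff)
  qed
  then have "monomial_prime V A =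
      {r \<in> monomial_span (exponents V). r * single m 1 \<in> (monomial_span E :: ('v, 'k) mpoly set)}"
    by (auto simp: mem_monomial_prime_iff)
  then show ?thesis
    using m(1) primeideal_monomial_prime[of V A, where 'k = 'k]
    by (auto simp: mem_assoc_primes_iff[OF cring_mpoly_ring ideal_monomial_span[OF assms(1)]]
        intro!: bexI[of _ "single m 1"] monomial_span_single)
qed

lemma ex_stable_multiplier:
  assumes "exponent_ideal V E" "finite M" "\<not> M \<subseteq> E"
  obtains n where "n \<in> exponents V" "{m \<in> M. n + m \<notin> E} \<noteq> {}"
    and "\<And>u. u \<in> exponents V \<Longrightarrow> {m \<in> M. u + n + m \<notin> E} \<noteq> {} \<Longrightarrow>
      {m \<in> M. u + n + m \<notin> E} = {m \<in> M. n + m \<notin> E}"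
proof -
  define B where "B n = {m \<in> M. n + m \<notin> E}" for n
  have "0 \<in> exponents V \<and> B 0 \<noteq> {}"
    using assms(3) by (auto simp: B_def)
  then obtain n where n: "n \<in> exponents V" "B n \<noteq> {}"
    and n_min: "\<And>n'. n' \<in> exponents V \<Longrightarrow> B n' \<noteq> {} \<Longrightarrow> card (B n) \<le> card (B n')"
    using ex_has_least_nat[of "\<lambda>n. n \<in> exponents V \<and> B n \<noteq> {}" 0 "\<lambda>n. card (B n)"] by blast
  have "B (u + n) = B n" if u: "u \<in> exponents V" "B (u + n) \<noteq> {}" for u
  proof (rule card_seteq)
    show "finite (B n)"
      using assms(2) by (simp add: B_def)
    show "B (u + n) \<subseteq> B n"
      using u(1) exponent_idealD(3)[OF assms(1)] by (auto simp: B_def add.assoc)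
    show "card (B n) \<le> card (B (u + n))"
      using u n by (intro n_min) simp_all
  qed
  with n show ?thesis
    by (intro that[of n]) (simp_all add: B_def)
qed

text \<open>Choose \<open>n\<close> such that as few monomials of \<open>n f\<close> as possible, but at least one, lie outside
  \<open>E\<close>. A monomial \<open>u\<close> then either leaves all of them outside \<open>E\<close> or moves all of them into \<open>E\<close>, and
  it does the latter iff it lies in the prime \<open>P\<close>, hence iff it involves one of the variables in
  \<open>P\<close>.\<close>

lemma ex_annihilator_multiplier:
  fixes P :: "('v, 'k::field) mpoly set"
  assumes E_ideal: "exponent_ideal V E" and P_prime: "primeideal P (mpoly_ring V)"
    and annihilator: "P = {r \<in> monomial_span (exponents V). r * f \<in> monomial_span E}"
  obtains n where "n \<in> exponents V" "{m \<in> keys f. n + m \<notin> E} \<noteq> {}"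
    and "\<And>u m. \<lbrakk>u \<in> exponents V; m \<in> keys f; n + m \<notin> E\<rbrakk> \<Longrightarrow>
      u + (n + m) \<in> E \<longleftrightarrow> u \<notin> exponents (V - {v \<in> V. var v \<in> P})"
proof -
  have monomial_mem: "single u 1 \<in> P \<longleftrightarrow> {m \<in> keys f. u + m \<notin> E} = {}"
    if "u \<in> exponents V" for u
    using that by (auto simp: annihilator monomial_span_def keys_single_times)
  have "\<not> keys f \<subseteq> E"
    using monomial_mem[of 0] monomial_mem_primeideal_iff[OF P_prime, of 0] by auto
  then obtain n where n: "n \<in> exponents V" "{m \<in> keys f. n + m \<notin> E} \<noteq> {}"
    and stable: "\<And>u. u \<in> exponents V \<Longrightarrow> {m \<in> keys f. u + n + m \<notin> E} \<noteq> {} \<Longrightarrow>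
      {m \<in> keys f. u + n + m \<notin> E} = {m \<in> keys f. n + m \<notin> E}"
    using ex_stable_multiplier[OF E_ideal finite_keys, of f] by blast
  have "u + (n + m) \<in> E \<longleftrightarrow> u \<notin> exponents (V - {v \<in> V. var v \<in> P})"
    if u: "u \<in> exponents V" and m: "m \<in> keys f" "n + m \<notin> E" for u m
  proof -
    have "u + (n + m) \<in> E \<longleftrightarrow> {m \<in> keys f. u + n + m \<notin> E} = {}"
      using stable[OF u] m by (auto simp: add.assoc)
    also have "\<dots> \<longleftrightarrow> single (u + n) 1 \<in> P"
      using monomial_mem[of "u + n"] u n(1) by simp
    also have "\<dots> \<longleftrightarrow> single u 1 \<in> P"
      using single_add_mem_primeideal_iff[OF P_prime u n(1)] monomial_mem[OF n(1)] n(2) by blast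
    also have "\<dots> \<longleftrightarrow> u \<notin> exponents (V - {v \<in> V. var v \<in> P})"
      unfolding monomial_mem_primeideal_iff[OF P_prime u] using u by (auto simp: exponents_def)
    finally show ?thesis .
  qed
  with n show ?thesis
    by (rule that)
qed

lemma annihilator_subset_monomial_prime:
  fixes f :: "('v, 'k::field) mpoly"
  assumes E_ideal: "exponent_ideal V E"
    and n: "n \<in> exponents V" "{m \<in> keys f. n + m \<notin> E} \<noteq> {}"
    and n_iff: "\<And>u m. \<lbrakk>u \<in> exponents V; m \<in> keys f; n + m \<notin> E\<rbrakk> \<Longrightarrow>
      u + (n + m) \<in> E \<longleftrightarrow> u \<notin> exponents (V - A)"
    and r: "r \<in> monomial_span (exponents V)" "r * f \<in> monomial_span E"
  shows "r \<in> monomial_prime V A"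
proof (rule ccontr)
  let ?X = "keys r \<inter> exponents (V - A)" and ?Y = "{m \<in> keys f. n + m \<notin> E}"
  assume "r \<notin> monomial_prime V A"
  then have "?X \<noteq> {}"
    using r(1) by (auto simp: mem_monomial_prime_iff)
  moreover have "p' \<in> ?X \<and> q' \<in> ?Y"
    if pq: "p \<in> ?X" "q \<in> ?Y" "p' \<in> keys r" "q' \<in> keys f" "p' + q' = p + q" for p q p' q'
  proof -
    have p: "p \<in> exponents V" "p' \<in> exponents V"
      using pq r(1) by (auto simp: monomial_span_def)
    have "p + (n + q) \<notin> E"
      using n_iff[OF p(1)] pq(1,2) by simp
    then have "p' + (n + q') \<notin> E"
      using pq(5) by (metis add.left_commute)
    then show ?thesis
      using pq(3,4) p(2) n_iff[of p' q'] exponent_idealD(3)[OF E_ideal, of "n + q'" p'] by auto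
  qed
  ultimately obtain p q where pq: "p \<in> ?X" "q \<in> ?Y" "p + q \<in> keys (r * f)"
    using ex_add_mem_keys_times[of ?X r ?Y f] n(2) by blast
  then have "n + (p + q) \<in> E"
    using r(2) n(1) exponent_idealD(3)[OF E_ideal] by (auto simp: monomial_span_def)
  then show False
    using n_iff[of p q] pq exponents_Diff_subset[of p V A] by (simp add: add.left_commute)
qed

lemma assoc_prime_monomial_span:
  fixes P :: "('v, 'k::field) mpoly set"
  assumes E_ideal: "exponent_ideal V E" and "P \<in> assoc_primes (mpoly_ring V) (monomial_span E)"
  defines "A \<equiv> {v \<in> V. var v \<in> P}"
  shows "associated_vars V E A" "P = monomial_prime V A"
proof -
  obtain f where P_prime: "primeideal P (mpoly_ring V)" and f_in: "f \<in> monomial_span (exponents V)"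
    and annihilator: "P = {r \<in> monomial_span (exponents V). r * f \<in> monomial_span E}"
    using assms(2)
    by (auto simp: mem_assoc_primes_iff[OF cring_mpoly_ring ideal_monomial_span[OF E_ideal]])
  obtain n where n: "n \<in> exponents V" "{m \<in> keys f. n + m \<notin> E} \<noteq> {}"
    and n_iff: "\<And>u m. \<lbrakk>u \<in> exponents V; m \<in> keys f; n + m \<notin> E\<rbrakk> \<Longrightarrow>
      u + (n + m) \<in> E \<longleftrightarrow> u \<notin> exponents (V - A)"
    using ex_annihilator_multiplier[OF E_ideal P_prime annihilator] unfolding A_def by blast
  obtain m where "m \<in> keys f" "n + m \<notin> E"
    using n(2) by blast
  moreover from this have "m \<in> exponents V"
    using f_in by (auto simp: monomial_span_def)
  ultimately show "associated_vars V E A"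
    unfolding associated_vars_def using n(1) n_iff
    by (intro conjI bexI[of _ "n + m"]) (auto simp: A_def)
  show "P = monomial_prime V A"
  proof
    show "monomial_prime V A \<subseteq> P"
      unfolding A_def by (rule monomial_prime_subset_primeideal[OF P_prime])
    show "P \<subseteq> monomial_prime V A"
      using annihilator_subset_monomial_prime[OF E_ideal n n_iff] annihilator by blast
  qed
qed

theorem assoc_primes_monomial_span:
  assumes "exponent_ideal V E"
  shows "assoc_primes (mpoly_ring V) (monomial_span E :: ('v, 'k::field) mpoly set) =
    monomial_prime V ` {A. associated_vars V E A}"
  using monomial_prime_mem_assoc_primes[OF assms, where 'k = 'k]
    assoc_prime_monomial_span[OF assms, where 'k = 'k] by blast


section \<open>Symbolic powers of monomial ideals\<close>

definition exponent_contraction :: "'v set \<Rightarrow> 'v set \<Rightarrow> ('v \<Rightarrow>\<^sub>0 nat) set \<Rightarrow> ('v \<Rightarrow>\<^sub>0 nat) set" where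
  "exponent_contraction V A F = {m \<in> exponents V. \<exists>u\<in>exponents (V - A). u + m \<in> F}"

lemma exponent_ideal_contraction:
  assumes "exponent_ideal V F"
  shows "exponent_ideal V (exponent_contraction V A F)"
proof (rule exponent_idealI)
  show "exponent_contraction V A F \<subseteq> exponents V"
    by (auto simp: exponent_contraction_def)
  fix m n assume "m \<in> exponent_contraction V A F" and n: "n \<in> exponents V"
  then obtain u where u: "m \<in> exponents V" "u \<in> exponents (V - A)" "u + m \<in> F"
    by (auto simp: exponent_contraction_def)
  then have "u + (n + m) \<in> F"
    using exponent_idealD(3)[OF assms _ n] by (simp add: add.left_commute)
  then show "n + m \<in> exponent_contraction V A F"
    using u n by (auto simp: exponent_contraction_def)
qed

lemma exponent_contraction_add_cancel:
  assumes "p \<in> exponents (V - A)" "m \<in> exponents V" "p + m \<in> exponent_contraction V A F"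
  shows "m \<in> exponent_contraction V A F"
proof -
  obtain u where "u \<in> exponents (V - A)" "(u + p) + m \<in> F"
    using assms(3) by (auto simp: exponent_contraction_def add.assoc)
  then show ?thesis
    unfolding exponent_contraction_def using assms(1,2)
    by (blast intro: add_in_exponents_iff[THEN iffD2])
qed

lemma add_eq_add_imp_not_in_contraction:
  assumes F_ideal: "exponent_ideal V F" and "p \<in> exponents (V - A)" "p' \<in> exponents V"
    and q: "q \<in> exponents V" "q \<notin> exponent_contraction V A F" and "p' + q' = p + q"
  shows "q' \<notin> exponent_contraction V A F"
proof
  assume "q' \<in> exponent_contraction V A F"
  then have "p' + q' \<in> exponent_contraction V A F"
    using exponent_idealD(3)[OF exponent_ideal_contraction[OF F_ideal]] assms(3) by blast
  then show False
    using exponent_contraction_add_cancel[OF assms(2) q(1)] q(2) assms(6) by simp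
qed

definition degree_in :: "'v set \<Rightarrow> ('v \<Rightarrow>\<^sub>0 nat) \<Rightarrow> nat" where
  "degree_in A m = (\<Sum>a\<in>A. lookup m a)"

lemma degree_in_add: "degree_in A (m + n) = degree_in A m + degree_in A n"
  by (simp add: degree_in_def lookup_add sum.distrib)

lemma degree_in_eq_0_iff:
  "finite A \<Longrightarrow> m \<in> exponents V \<Longrightarrow> degree_in A m = 0 \<longleftrightarrow> m \<in> exponents (V - A)"
  by (auto simp: degree_in_def exponents_def in_keys_iff)

text \<open>Among the monomials of \<open>f\<close> outside the contraction, those of least degree in \<open>A\<close> do not cancel
  against anything when they are multiplied by the monomials of \<open>u\<close> that avoid \<open>A\<close>.\<close>

lemma keys_subset_exponent_contraction:
  fixes f u :: "('v, 'k::field) mpoly"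
  assumes A_finite: "finite A" and F_ideal: "exponent_ideal V F"
    and f_in: "f \<in> monomial_span (exponents V)"
    and u: "u \<in> monomial_span (exponents V)" "u \<notin> monomial_prime V A"
    and uf: "u * f \<in> monomial_span F"
  shows "keys f \<subseteq> exponent_contraction V A F"
proof (rule ccontr)
  let ?C = "exponent_contraction V A F"
  assume "\<not> keys f \<subseteq> ?C"
  then obtain q\<^sub>0 where q\<^sub>0: "q\<^sub>0 \<in> keys f - ?C"
    and q\<^sub>0_min: "\<And>q. q \<in> keys f - ?C \<Longrightarrow> degree_in A q\<^sub>0 \<le> degree_in A q"
    using ex_has_least_nat[of "\<lambda>q. q \<in> keys f - ?C" _ "degree_in A"] by blast
  let ?X = "keys u \<inter> exponents (V - A)"
  let ?Y = "{q \<in> keys f - ?C. degree_in A q = degree_in A q\<^sub>0}"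
  have keys: "keys u \<subseteq> exponents V" "keys f \<subseteq> exponents V"
    using f_in u(1) by (simp_all add: monomial_span_def)
  have "p' \<in> ?X \<and> q' \<in> ?Y"
    if pq: "p \<in> ?X" "q \<in> ?Y" "p' \<in> keys u" "q' \<in> keys f" "p' + q' = p + q" for p q p' q'
  proof -
    have "q' \<notin> ?C"
      using pq keys add_eq_add_imp_not_in_contraction[OF F_ideal, of p A p' q q'] by blast
    then have "degree_in A q \<le> degree_in A q'"
      using pq(2,4) q\<^sub>0_min[of q'] by simp
    moreover have "degree_in A p' + degree_in A q' = degree_in A p + degree_in A q"
      using pq(5) by (metis degree_in_add)
    moreover have "degree_in A p = 0"
      using pq(1) keys A_finite degree_in_eq_0_iff[of A p V] by auto
    ultimately have "degree_in A p' = 0" "degree_in A q' = degree_in A q"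
      by simp_all
    then show ?thesis
      using pq keys A_finite degree_in_eq_0_iff[of A p' V] \<open>q' \<notin> ?C\<close> by auto
  qed
  moreover have "?X \<noteq> {}" "?Y \<noteq> {}"
    using u q\<^sub>0 by (auto simp: mem_monomial_prime_iff)
  ultimately obtain p q where pq: "p \<in> ?X" "q \<in> ?Y" "p + q \<in> keys (u * f)"
    using ex_add_mem_keys_times[of ?X u ?Y f] by blast
  then have "q \<in> ?C"
    using uf keys by (auto simp: monomial_span_def exponent_contraction_def)
  with pq(2) show False
    by blast
qed

lemma ex_common_multiplier:
  assumes "exponent_ideal V F" "finite M" "M \<subseteq> exponent_contraction V A F"
  shows "\<exists>u\<in>exponents (V - A). \<forall>m\<in>M. u + m \<in> F"
  using assms(2,3)
proof (induction M rule: finite_induct)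
  case empty
  show ?case
    by (intro bexI[of _ 0]) simp_all
next
  case (insert m M)
  then obtain u t where u: "u \<in> exponents (V - A)" "\<forall>m\<in>M. u + m \<in> F"
    and t: "t \<in> exponents (V - A)" "t + m \<in> F"
    by (auto simp: exponent_contraction_def)
  then have "u + (t + m) \<in> F" "\<forall>m\<in>M. t + (u + m) \<in> F"
    using exponent_idealD(3)[OF assms(1)] exponents_Diff_subset by blast+
  with u(1) t(1) show ?case
    by (intro bexI[of _ "t + u"]) (auto simp: add_ac)
qed

lemma saturation_monomial_span:
  assumes "finite A" "exponent_ideal V F"
  shows "saturation (mpoly_ring V) (carrier (mpoly_ring V) - monomial_prime V A) (monomial_span F) =
    (monomial_span (exponent_contraction V A F) :: ('v, 'k::field) mpoly set)" (is "?S = ?C")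
proof
  show "?S \<subseteq> ?C"
    using keys_subset_exponent_contraction[OF assms]
    by (auto simp: saturation_def monomial_span_def[of "exponent_contraction V A F"])
  show "?C \<subseteq> ?S"
  proof
    fix f assume f: "f \<in> ?C"
    then have "keys f \<subseteq> exponent_contraction V A F"
      by (simp add: monomial_span_def)
    then obtain u where u: "u \<in> exponents (V - A)" "\<forall>m\<in>keys f. u + m \<in> F"
      using ex_common_multiplier[OF assms(2) finite_keys] by blast
    have "single u 1 \<in> carrier (mpoly_ring V) - (monomial_prime V A :: ('v, 'k) mpoly set)"
      using u(1) exponents_Diff_subset[OF u(1)]
      by (auto simp: mem_monomial_prime_iff monomial_span_single)
    moreover have "single u 1 * f \<in> monomial_span F"
      using u(2) by (auto simp: monomial_span_def keys_single_times)
    moreover have "f \<in> monomial_span (exponents V)"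
      using f by (auto simp: monomial_span_def exponent_contraction_def)
    ultimately show "f \<in> ?S"
      by (auto simp: saturation_def)
  qed
qed

definition exponent_symbolic_power :: "'v set \<Rightarrow> ('v \<Rightarrow>\<^sub>0 nat) set \<Rightarrow> nat \<Rightarrow> ('v \<Rightarrow>\<^sub>0 nat) set" where
  "exponent_symbolic_power V E s =
    exponents V \<inter>
      (\<Inter>A \<in> {A. associated_vars V E A}. exponent_contraction V A (exponent_power V E s))"

theorem symbolic_power_monomial_span:
  assumes "finite V" "exponent_ideal V E"
  shows "symbolic_power (mpoly_ring V) (monomial_span E) s =
    (monomial_span (exponent_symbolic_power V E s) :: ('v, 'k::field) mpoly set)"
proof -
  note power_ideal = exponent_ideal_exponent_power[OF assms(2), of s]
  have "local_contraction (mpoly_ring V) (monomial_prime V A)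
      (monomial_span (exponent_power V E s) :: ('v, 'k) mpoly set) =
      monomial_span (exponent_contraction V A (exponent_power V E s))"
    if "associated_vars V E A" for A
  proof -
    have "finite A"
      using that assms(1) finite_subset by (auto simp: associated_vars_def)
    then show ?thesis
      by (simp only: local_contraction_eq_saturation[OF primeideal_monomial_prime
            ideal_monomial_span[OF power_ideal]] saturation_monomial_span[OF _ power_ideal])
  qed
  then have "symbolic_power (mpoly_ring V) (monomial_span E :: ('v, 'k) mpoly set) s =
      monomial_span (exponents V) \<inter> (\<Inter>A \<in> {A. associated_vars V E A}.
        monomial_span (exponent_contraction V A (exponent_power V E s)))"
    by (simp add: symbolic_power_def ideal_power_monomial_span assoc_primes_monomial_span assms(2))
  also have "\<dots> = monomial_span (exponent_symbolic_power V E s)"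
    by (auto simp: monomial_span_def exponent_symbolic_power_def)
  finally show ?thesis .
qed

lemma symbolic_eq_ordinary_iff:
  assumes "finite V" "exponent_ideal V E"
  shows "symbolic_power (mpoly_ring V) (monomial_span E :: ('v, 'k::field) mpoly set) s =
      ideal_power (mpoly_ring V) (monomial_span E) s \<longleftrightarrow>
    exponent_symbolic_power V E s = exponent_power V E s"
  by (simp add: symbolic_power_monomial_span[OF assms] ideal_power_monomial_span[OF assms(2)]
      monomial_span_eq_iff)


section \<open>Scaling exponents\<close>

definition scale_exponent :: "('v \<Rightarrow> nat) \<Rightarrow> ('v \<Rightarrow>\<^sub>0 nat) \<Rightarrow> ('v \<Rightarrow>\<^sub>0 nat)" where
  "scale_exponent c m = Poly_Mapping.mapp (\<lambda>v k. c v * k) m"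

definition floor_exponent :: "('v \<Rightarrow> nat) \<Rightarrow> ('v \<Rightarrow>\<^sub>0 nat) \<Rightarrow> ('v \<Rightarrow>\<^sub>0 nat)" where
  "floor_exponent c m = Poly_Mapping.mapp (\<lambda>v k. k div c v) m"

lemma lookup_scale_exponent [simp]: "lookup (scale_exponent c m) v = c v * lookup m v"
  by (simp add: scale_exponent_def lookup_mapp when_def in_keys_iff)

lemma lookup_floor_exponent [simp]: "lookup (floor_exponent c m) v = lookup m v div c v"
  by (simp add: floor_exponent_def lookup_mapp when_def in_keys_iff)

lemma scale_exponent_add: "scale_exponent c (m + n) = scale_exponent c m + scale_exponent c n"
  by (rule poly_mapping_eqI) (simp add: lookup_add distrib_left)

lemma scale_exponent_single: "scale_exponent c (single v k) = single v (c v * k)"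
  by (rule poly_mapping_eqI) (simp add: lookup_single when_def)

lemma exponent_ideal_mono:
  assumes "exponent_ideal V E" "m \<in> E" "n \<in> exponents V" "\<And>v. lookup m v \<le> lookup n v"
  shows "n \<in> E"
proof -
  have n: "n = (n - m) + m"
    using assms(4) by (intro poly_mapping_eqI) (simp add: lookup_add lookup_minus)
  then have "n - m \<in> exponents V"
    using assms(3) by (metis add_in_exponents_iff)
  then show ?thesis
    using n exponent_idealD(3)[OF assms(1,2)] by metis
qed

locale exponent_scaling =
  fixes V :: "'v set" and c :: "'v \<Rightarrow> nat"
  assumes c_pos: "c v > 0"
begin

text \<open>The exponents of the extension of the ideal with exponents \<open>E\<close> along the substitution
  \<open>x \<mapsto> x ^ c x\<close>.\<close>

definition pullback :: "('v \<Rightarrow>\<^sub>0 nat) set \<Rightarrow> ('v \<Rightarrow>\<^sub>0 nat) set" where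
  "pullback E = {m \<in> exponents V. floor_exponent c m \<in> E}"

lemma keys_scale_exponent [simp]: "keys (scale_exponent c m) = keys m"
proof -
  have "lookup (scale_exponent c m) v \<noteq> 0 \<longleftrightarrow> lookup m v \<noteq> 0" for v
    using c_pos[of v] by simp
  then show ?thesis
    by (simp add: in_keys_iff set_eq_iff del: lookup_scale_exponent)
qed

lemma scale_exponent_in_exponents_iff [simp]:
  "scale_exponent c m \<in> exponents W \<longleftrightarrow> m \<in> exponents W"
  by (simp add: exponents_def)

lemma floor_exponent_in_exponents [simp]:
  "m \<in> exponents W \<Longrightarrow> floor_exponent c m \<in> exponents W"
  using keys_mapp_subset[of "\<lambda>v k. k div c v" m]
  unfolding exponents_def floor_exponent_def by blast

lemma floor_scale_add [simp]:
  "floor_exponent c (scale_exponent c n + m) = n + floor_exponent c m"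
  by (rule poly_mapping_eqI) (use c_pos in \<open>simp add: lookup_add\<close>)

lemma floor_scale [simp]: "floor_exponent c (scale_exponent c n) = n"
  by (rule poly_mapping_eqI) (use c_pos in simp)

lemma floor_add_ge:
  "lookup (floor_exponent c m + floor_exponent c n) v \<le> lookup (floor_exponent c (m + n)) v"
proof -
  have "c v * (lookup m v div c v + lookup n v div c v) \<le> lookup m v + lookup n v"
    unfolding distrib_left by (intro add_mono times_div_less_eq_dividend)
  then show ?thesis
    using c_pos by (simp add: lookup_add less_eq_div_iff_mult_less_eq mult.commute)
qed

lemma floor_add_le: "lookup (floor_exponent c (n + m)) v \<le> lookup (n + floor_exponent c m) v"
proof -
  have "(lookup n v + lookup m v) div c v \<le> (lookup n v * c v + lookup m v) div c v"
    using c_pos[of v] by (intro div_le_mono) simp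
  then show ?thesis
    using c_pos[of v] by (simp add: lookup_add)
qed

lemma floor_eq_addE:
  assumes "floor_exponent c m = e + f"
  obtains m' where "m = scale_exponent c e + m'" "floor_exponent c m' = f"
proof
  have "c v * lookup e v \<le> lookup m v" for v
  proof -
    have "lookup m v div c v = lookup e v + lookup f v"
      using arg_cong[OF assms, of "\<lambda>p. lookup p v"] by (simp add: lookup_add)
    then have "c v * lookup e v \<le> c v * (lookup m v div c v)"
      by simp
    then show ?thesis
      using times_div_less_eq_dividend order_trans by blast
  qed
  then show m: "m = scale_exponent c e + (m - scale_exponent c e)"
    by (intro poly_mapping_eqI) (simp add: lookup_add lookup_minus)
  have "e + floor_exponent c (m - scale_exponent c e) = e + f"
    using assms floor_scale_add[of e "m - scale_exponent c e"] by (simp flip: m)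
  then show "floor_exponent c (m - scale_exponent c e) = f"
    by simp
qed

lemma pullback_eq_iff:
  assumes "E \<subseteq> exponents V" "F \<subseteq> exponents V"
  shows "pullback E = pullback F \<longleftrightarrow> E = F"
proof
  assume "pullback E = pullback F"
  moreover have "e \<in> E \<longleftrightarrow> scale_exponent c e \<in> pullback E"
    "e \<in> F \<longleftrightarrow> scale_exponent c e \<in> pullback F" for e
    using assms by (auto simp: pullback_def)
  ultimately show "E = F"
    by blast
qed simp

lemma pullback_exponents: "pullback (exponents V) = exponents V"
  by (auto simp: pullback_def)

lemma exponent_ideal_pullback:
  assumes "exponent_ideal V E"
  shows "exponent_ideal V (pullback E)"
proof (rule exponent_idealI)
  show "pullback E \<subseteq> exponents V"
    by (auto simp: pullback_def)
  fix m n assume m: "m \<in> pullback E" and n: "n \<in> exponents V"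
  then have "floor_exponent c n + floor_exponent c m \<in> E"
    using exponent_idealD(3)[OF assms] by (simp add: pullback_def)
  then have "floor_exponent c (n + m) \<in> E"
    using m n by (intro exponent_ideal_mono[OF assms _ _ floor_add_ge]) (simp_all add: pullback_def)
  then show "n + m \<in> pullback E"
    using m n by (simp add: pullback_def)
qed

lemma pullback_generated:
  assumes "G \<subseteq> exponents V"
  shows "pullback (exponents V + G) = exponents V + scale_exponent c ` G"
proof (intro equalityI subsetI)
  fix m assume "m \<in> pullback (exponents V + G)"
  then obtain n g where "floor_exponent c m = g + n" "g \<in> G" "m \<in> exponents V"
    by (auto simp: pullback_def add.commute elim!: set_plus_elim)
  then obtain m' where "m = m' + scale_exponent c g" "m' \<in> exponents V" "g \<in> G"
    by (metis add.commute add_in_exponents_iff floor_eq_addE)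
  then show "m \<in> exponents V + scale_exponent c ` G"
    by blast
next
  fix m assume "m \<in> exponents V + scale_exponent c ` G"
  then obtain n g where m: "m = scale_exponent c g + n" and "g \<in> G" "n \<in> exponents V"
    by (auto simp: add.commute elim!: set_plus_elim)
  moreover have "floor_exponent c m = floor_exponent c n + g"
    unfolding m floor_scale_add by (rule add.commute)
  moreover have "m \<in> exponents V"
    using calculation assms by auto
  ultimately show "m \<in> pullback (exponents V + G)"
    by (auto simp: pullback_def)
qed

lemma pullback_set_plus:
  assumes "exponent_ideal V E" "exponent_ideal V F"
  shows "pullback (E + F) = pullback E + pullback F"
proof (intro equalityI subsetI)
  fix m assume "m \<in> pullback (E + F)"
  then obtain e f where ef: "floor_exponent c m = e + f" "e \<in> E" "f \<in> F" "m \<in> exponents V"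
    by (auto simp: pullback_def elim!: set_plus_elim)
  then obtain m' where m: "m = scale_exponent c e + m'" "floor_exponent c m' = f"
    by (elim floor_eq_addE)
  with ef have "scale_exponent c e \<in> pullback E" "m' \<in> pullback F"
    by (auto simp: pullback_def)
  with m(1) show "m \<in> pullback E + pullback F"
    by blast
next
  fix m assume "m \<in> pullback E + pullback F"
  then obtain a b where m: "m = a + b" and ab: "a \<in> pullback E" "b \<in> pullback F"
    by (rule set_plus_elim)
  then have "floor_exponent c a + floor_exponent c b \<in> E + F"
    by (auto simp: pullback_def)
  moreover have "exponent_ideal V (E + F)"
    using assms by (simp add: exponent_ideal_set_plus exponent_idealD(1))
  ultimately have "floor_exponent c (a + b) \<in> E + F"
    using ab exponent_ideal_mono[OF _ _ _ floor_add_ge] by (simp add: pullback_def)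
  then show "m \<in> pullback (E + F)"
    using m ab by (simp add: pullback_def)
qed

lemma exponent_power_pullback:
  assumes "exponent_ideal V E"
  shows "exponent_power V (pullback E) s = pullback (exponent_power V E s)"
  by (induction s)
    (simp_all add: pullback_exponents pullback_set_plus exponent_ideal_exponent_power assms)

text \<open>The witness is the largest exponent vector whose floor is 0.\<close>

lemma ex_keys_floor_add_eq:
  assumes "finite V"
  shows "\<exists>r\<in>exponents V. \<forall>n\<in>exponents V. keys (floor_exponent c (n + r)) = keys n"
proof -
  define r where "r = (\<Sum>v\<in>V. single v (c v - 1))"
  have lookup_r: "lookup r v = (if v \<in> V then c v - 1 else 0)" for v
    unfolding r_def lookup_sum using assms by (simp add: lookup_single when_def)
  then have r: "r \<in> exponents V"
    by (auto simp: exponents_def in_keys_iff split: if_splits)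
  have "v \<in> keys (floor_exponent c (n + r)) \<longleftrightarrow> v \<in> keys n" if "n \<in> exponents V" for n v
  proof (cases "v \<in> V")
    case True
    then show ?thesis
      using c_pos[of v] by (auto simp: in_keys_iff lookup_add lookup_r div_eq_0_iff)
  next
    case False
    then show ?thesis
      using that r floor_exponent_in_exponents[of "n + r" V]
      by (auto simp: exponents_def keys_add_nat)
  qed
  with r show ?thesis
    by blast
qed

lemma associated_vars_pullback_iff:
  assumes "finite V"
  shows "associated_vars V (pullback E) A \<longleftrightarrow> associated_vars V E A"
proof
  assume "associated_vars V (pullback E) A"
  then obtain m where m: "A \<subseteq> V" "m \<in> exponents V"
    "\<And>n. n \<in> exponents V \<Longrightarrow> n + m \<in> pullback E \<longleftrightarrow> n \<notin> exponents (V - A)"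
    by (auto simp: associated_vars_def)
  have "n + floor_exponent c m \<in> E \<longleftrightarrow> n \<notin> exponents (V - A)" if "n \<in> exponents V" for n
    using m(2) m(3)[of "scale_exponent c n"] that by (simp add: pullback_def)
  then show "associated_vars V E A"
    unfolding associated_vars_def using m(1,2) floor_exponent_in_exponents by blast
next
  assume "associated_vars V E A"
  then obtain m where m: "A \<subseteq> V" "m \<in> exponents V"
    "\<And>n. n \<in> exponents V \<Longrightarrow> n + m \<in> E \<longleftrightarrow> n \<notin> exponents (V - A)"
    by (auto simp: associated_vars_def)
  obtain r where r: "r \<in> exponents V"
    "\<And>n. n \<in> exponents V \<Longrightarrow> keys (floor_exponent c (n + r)) = keys n"
    using ex_keys_floor_add_eq[OF assms] by blast
  have "n + (scale_exponent c m + r) \<in> pullback E \<longleftrightarrow> n \<notin> exponents (V - A)"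
    if n: "n \<in> exponents V" for n
  proof -
    have "floor_exponent c (n + (scale_exponent c m + r)) = floor_exponent c (n + r) + m"
      using floor_scale_add[of m "n + r"] by (simp add: ac_simps)
    then have "n + (scale_exponent c m + r) \<in> pullback E \<longleftrightarrow> floor_exponent c (n + r) + m \<in> E"
      using m(2) n r(1) by (simp add: pullback_def)
    also have "\<dots> \<longleftrightarrow> n \<notin> exponents (V - A)"
      using m(3)[of "floor_exponent c (n + r)"] n r by (simp add: exponents_def)
    finally show ?thesis .
  qed
  then show "associated_vars V (pullback E) A"
    using m r(1) by (auto simp: associated_vars_def intro!: bexI[of _ "scale_exponent c m + r"])
qed

lemma exponent_contraction_pullback:
  assumes "exponent_ideal V F"
  shows "exponent_contraction V A (pullback F) = pullback (exponent_contraction V A F)"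
proof (intro equalityI subsetI)
  fix m assume "m \<in> exponent_contraction V A (pullback F)"
  then obtain u where u: "u \<in> exponents (V - A)" "floor_exponent c (u + m) \<in> F"
    and m: "m \<in> exponents V"
    by (auto simp: exponent_contraction_def pullback_def)
  have "u + floor_exponent c m \<in> F"
    using u m exponents_Diff_subset
    by (intro exponent_ideal_mono[OF assms u(2) _ floor_add_le]) auto
  with u(1) m show "m \<in> pullback (exponent_contraction V A F)"
    by (auto simp: exponent_contraction_def pullback_def)
next
  fix m assume "m \<in> pullback (exponent_contraction V A F)"
  then obtain u where u: "u \<in> exponents (V - A)" "u + floor_exponent c m \<in> F"
    and m: "m \<in> exponents V"
    by (auto simp: exponent_contraction_def pullback_def)
  have "scale_exponent c u + m \<in> pullback F"
    using u m exponents_Diff_subset[OF u(1)] by (simp add: pullback_def)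
  with u(1) m show "m \<in> exponent_contraction V A (pullback F)"
    by (auto simp: exponent_contraction_def intro!: bexI[of _ "scale_exponent c u"])
qed

lemma exponent_symbolic_power_pullback:
  assumes "finite V" "exponent_ideal V E"
  shows "exponent_symbolic_power V (pullback E) s = pullback (exponent_symbolic_power V E s)"
proof -
  have "exponent_symbolic_power V (pullback E) s = exponents V \<inter>
      (\<Inter>A \<in> {A. associated_vars V E A}. pullback (exponent_contraction V A (exponent_power V E s)))"
    by (simp add: exponent_symbolic_power_def associated_vars_pullback_iff exponent_power_pullback
        exponent_contraction_pullback exponent_ideal_exponent_power assms)
  also have "\<dots> = pullback (exponent_symbolic_power V E s)"
    by (auto simp: pullback_def exponent_symbolic_power_def)
  finally show ?thesis .
qed

theorem symbolic_eq_ordinary_pullback_iff: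
  assumes "finite V" "exponent_ideal V E"
  shows "symbolic_power (mpoly_ring V) (monomial_span (pullback E) :: ('v, 'k::field) mpoly set) s =
      ideal_power (mpoly_ring V) (monomial_span (pullback E)) s \<longleftrightarrow>
    symbolic_power (mpoly_ring V) (monomial_span E :: ('v, 'k) mpoly set) s =
      ideal_power (mpoly_ring V) (monomial_span E) s"
proof -
  have "exponent_symbolic_power V E s \<subseteq> exponents V" "exponent_power V E s \<subseteq> exponents V"
    using exponent_idealD(1)[OF exponent_ideal_exponent_power[OF assms(2)]]
    by (auto simp: exponent_symbolic_power_def)
  then show ?thesis
    by (simp add: symbolic_eq_ordinary_iff assms exponent_ideal_pullback
        exponent_symbolic_power_pullback exponent_power_pullback pullback_eq_iff)
qed

end


section \<open>Edge ideals\<close>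

definition edge_exponents :: "('v, 'm) wo_graph_scheme \<Rightarrow> ('v \<Rightarrow>\<^sub>0 nat) set" where
  "edge_exponents D = (\<lambda>(x, y). single x 1 + single y (weight D y)) ` edges D"

lemma edge_exponents_subset:
  "edges D \<subseteq> verts D \<times> verts D \<Longrightarrow> edge_exponents D \<subseteq> exponents (verts D)"
  by (auto simp: edge_exponents_def)

lemma var_power: "var y ^ k = single (single y k) 1"
proof (induction k)
  case (Suc k)
  have "single y 1 + single y k = single y (Suc k)"
    by (simp flip: single_add)
  with Suc show ?case
    by (simp add: var_def mult_single)
qed simp

lemma edge_ideal_eq_monomial_span:
  assumes "edges D \<subseteq> verts D \<times> verts D"
  shows "(edge_ideal D :: ('v, 'k::field) mpoly set) =
    monomial_span (exponents (verts D) + edge_exponents D)"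
proof -
  have "(var x :: ('v, 'k) mpoly) * var y ^ w = single (single x 1 + single y w) 1" for x y w
    unfolding var_power by (simp add: var_def mult_single)
  then have "{var x * var y ^ weight D y |x y. (x, y) \<in> edges D} =
      (\<lambda>m. single m (1::'k)) ` edge_exponents D"
    by (auto simp: edge_exponents_def image_iff split: prod.splits)
  then show ?thesis
    unfolding edge_ideal_def using genideal_monomials[OF edge_exponents_subset[OF assms]] by simp
qed

theorem symbolic_eq_ordinary_edge_ideal_reweight_iff:
  fixes D D' :: "('v, 'm) wo_graph_scheme"
  assumes "finite (verts D)" "edges D \<subseteq> verts D \<times> verts D"
    and D': "verts D' = verts D" "edges D' = edges D"
    and c_pos: "\<And>v. c v > 0"
    and c_tail: "\<And>x y. (x, y) \<in> edges D \<Longrightarrow> c x = 1"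
    and c_head: "\<And>x y. (x, y) \<in> edges D \<Longrightarrow> weight D y = c y * weight D' y"
  shows "symbolic_power (mpoly_ring (verts D)) (edge_ideal D' :: ('v, 'k::field) mpoly set) s =
      ideal_power (mpoly_ring (verts D)) (edge_ideal D') s \<longleftrightarrow>
    symbolic_power (mpoly_ring (verts D)) (edge_ideal D :: ('v, 'k) mpoly set) s =
      ideal_power (mpoly_ring (verts D)) (edge_ideal D) s"
proof -
  interpret exponent_scaling "verts D" c
    by unfold_locales (rule c_pos)
  have "scale_exponent c (single x 1 + single y (weight D' y)) = single x 1 + single y (weight D y)"
    if "(x, y) \<in> edges D" for x y
    using c_tail[OF that] c_head[OF that] by (simp add: scale_exponent_add scale_exponent_single)
  then have "edge_exponents D = scale_exponent c ` edge_exponents D'"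
    unfolding edge_exponents_def D' image_image by (intro image_cong) auto
  moreover have edges': "edge_exponents D' \<subseteq> exponents (verts D)"
    using edge_exponents_subset[of D'] assms(2) D' by simp
  ultimately have "edge_ideal D = (monomial_span (pullback (exponents (verts D) + edge_exponents D'))
      :: ('v, 'k) mpoly set)"
    by (simp add: edge_ideal_eq_monomial_span pullback_generated assms(2))
  moreover have "edge_ideal D' = (monomial_span (exponents (verts D) + edge_exponents D')
      :: ('v, 'k) mpoly set)"
    using edge_ideal_eq_monomial_span[of D'] assms(2) D' by simp
  moreover have "exponent_ideal (verts D) (exponents (verts D) + edge_exponents D')"
    using exponent_ideal_exponents edges' by (rule exponent_ideal_set_plus)
  ultimately show ?thesis
    by (simp add: symbolic_eq_ordinary_pullback_iff assms(1))
qed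

theorem corollary4p6:
  fixes D D' :: "'v wo_graph"
    and U :: "'v set"
    and R :: "('v, 'k::field) mpoly ring"
    and I I' :: "('v, 'k) mpoly set"
    and s :: nat
  assumes "weighted_oriented_graph D"
    and "U = {x \<in> nontrivial_verts D. is_sink D x}"
    and "D' = D\<lparr>weight := (\<lambda>x. if x \<in> U then 1 else weight D x)\<rparr>"
    and "R = mpoly_ring (verts D)"
    and "I = edge_ideal D"
    and "I' = edge_ideal D'"
    and "s \<ge> 1"
  shows "symbolic_power R I' s = ideal_power R I' s
     \<longleftrightarrow> symbolic_power R I s = ideal_power R I s"
proof -
  interpret weighted_oriented_graph D by fact
  define c where "c v = (if v \<in> U then weight D v else 1)" for v
  show ?thesis
    unfolding assms(4-6)
  proof (rule symbolic_eq_ordinary_edge_ideal_reweight_iff[where c = c])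
    show "c v > 0" for v
      using weight_pos[of v] assms(2) by (auto simp: c_def nontrivial_verts_def)
    show "c x = 1" if "(x, y) \<in> edges D" for x y
      using that assms(2) by (auto simp: c_def is_sink_def)
    show "weight D y = c y * weight D' y" for y
      using assms(3) by (simp add: c_def)
  qed (simp_all add: assms(3) finite_verts edges_in_verts)
qed

end
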